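(* Let $\Omega\subset\mathbb{C}$ be a bounded domain with $\mathcal{C}^\infty$-smooth boundary. Then the following are equivalent: (i) the Bergman projection of $\Omega$ maps polynomials to polynomials, i.e. for every polynomial $q(z,\bar z)$ with complex coefficients, the Bergman projection of $q|_\Omega$ is (the restriction to $\Omega$ of) a polynomial; (ii) the Dirichlet problem solution operator on $\Omega$ takes polynomial boundary data to polynomials, i.e. for every polynomial $Q(z,\bar z)$ with complex coefficients, the function that is continuous on $\overline{\Omega}$, harmonic in $\Omega$ and equal to $Q$ on the boundary of $\Omega$ is (the restriction to $\overline{\Omega}$ of) a polynomial in $z,\bar z$.
   Context: For a domain $\Omega\subset\mathbb{C}$, $L^2(\Omega)$ is the space of complex-valued functions square-integrable with respect to Lebesgue measure $dV$, with inner product $\langle f,g\rangle=\int_\Omega f\bar g\,dV$, and $H^2(\Omega)$ is its closed subspace of holomorphic functions (the Bergman space). The Bergman projection of $\Omega$ is the orthogonal projection of $L^2(\Omega)$ onto $H^2(\Omega)$. "Polynomial" means a complex-valued polynomial function of the real coordinates $x=\operatorname{Re}z$, $y=\operatorname{Im}z$, equivalently of $z$ and $\bar z$. The Dirichlet problem is for the Laplacian. Domains are connected open sets, not assumed simply connected. *)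

theory Defs
  imports "HOL-Analysis.Analysis"
begin

text \<open>
  Polynomials in the real coordinates are the library's \<^const>\<open>polynomial_function\<close> at type
  \<^typ>\<open>complex \<Rightarrow> complex\<close>: its real and imaginary parts are built from real-linear
  functionals of the argument (that is, combinations of \<^const>\<open>Re\<close> and \<^const>\<open>Im\<close>) and
  constants by addition and multiplication.
\<close>

primrec Ck_on :: "nat \<Rightarrow> complex set \<Rightarrow> (complex \<Rightarrow> 'b::real_normed_vector) \<Rightarrow> bool" where
  "Ck_on 0 U f \<longleftrightarrow> continuous_on U f"
| "Ck_on (Suc k) U f \<longleftrightarrow> (\<forall>z\<in>U. f differentiable (at z)) \<and>
     (\<forall>v. Ck_on k U (\<lambda>z. frechet_derivative f (at z) v))"

text \<open>Only used for open sets \<open>U\<close>; differentiability is real differentiability.\<close>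

definition smooth_on :: "complex set \<Rightarrow> (complex \<Rightarrow> 'b::real_normed_vector) \<Rightarrow> bool" where
  "smooth_on U f \<longleftrightarrow> (\<forall>k. Ck_on k U f)"

text \<open>
  Local defining functions. For open \<open>\<Omega>\<close> the condition forces \<open>r p = 0\<close>, and the
  one-sided description of \<open>\<Omega>\<close> rules out slits.
\<close>

definition smooth_boundary :: "complex set \<Rightarrow> bool" where
  "smooth_boundary \<Omega> \<longleftrightarrow>
     (\<forall>p\<in>frontier \<Omega>. \<exists>U. \<exists>r::complex \<Rightarrow> real. open U \<and> p \<in> U \<and> smooth_on U r \<and>
        (\<exists>v. frechet_derivative r (at p) v \<noteq> 0) \<and> \<Omega> \<inter> U = {z\<in>U. r z < 0})"

text \<open>
  Representatives are functions on all of \<^typ>\<open>complex\<close>; every notion below depends only on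
  their values on \<open>\<Omega>\<close> (for the Dirichlet problem, on its closure).
\<close>

definition L2 :: "complex set \<Rightarrow> (complex \<Rightarrow> complex) set" where
  "L2 \<Omega> = {f. f \<in> borel_measurable (lebesgue_on \<Omega>) \<and>
               integrable (lebesgue_on \<Omega>) (\<lambda>z. (cmod (f z))\<^sup>2)}"

definition L2_inner :: "complex set \<Rightarrow> (complex \<Rightarrow> complex) \<Rightarrow> (complex \<Rightarrow> complex) \<Rightarrow> complex" where
  "L2_inner \<Omega> f g = (LINT z|lebesgue_on \<Omega>. f z * cnj (g z))"

definition bergman_space :: "complex set \<Rightarrow> (complex \<Rightarrow> complex) set" where
  "bergman_space \<Omega> = {f \<in> L2 \<Omega>. f holomorphic_on \<Omega>}"

text \<open>
  The graph of the orthogonal projection onto the closed subspace \<^const>\<open>bergman_space\<close>: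
  the function \<open>h\<close> is unique up to its values off \<open>\<Omega>\<close>.
\<close>

definition is_bergman_projection ::
    "complex set \<Rightarrow> (complex \<Rightarrow> complex) \<Rightarrow> (complex \<Rightarrow> complex) \<Rightarrow> bool" where
  "is_bergman_projection \<Omega> f h \<longleftrightarrow> f \<in> L2 \<Omega> \<and> h \<in> bergman_space \<Omega> \<and>
     (\<forall>g\<in>bergman_space \<Omega>. L2_inner \<Omega> (\<lambda>z. f z - h z) g = 0)"

definition laplacian :: "(complex \<Rightarrow> complex) \<Rightarrow> complex \<Rightarrow> complex" where
  "laplacian u z =
     frechet_derivative (\<lambda>w. frechet_derivative u (at w) 1) (at z) 1 +
     frechet_derivative (\<lambda>w. frechet_derivative u (at w) \<i>) (at z) \<i>"

definition harmonic_on :: "complex set \<Rightarrow> (complex \<Rightarrow> complex) \<Rightarrow> bool" where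
  "harmonic_on U u \<longleftrightarrow> Ck_on 2 U u \<and> (\<forall>z\<in>U. laplacian u z = 0)"

text \<open>On bounded open sets, \<open>u\<close> is unique on the closure by the maximum principle.\<close>

definition is_dirichlet_solution ::
    "complex set \<Rightarrow> (complex \<Rightarrow> complex) \<Rightarrow> (complex \<Rightarrow> complex) \<Rightarrow> bool" where
  "is_dirichlet_solution \<Omega> \<phi> u \<longleftrightarrow>
     continuous_on (closure \<Omega>) u \<and> harmonic_on \<Omega> u \<and> (\<forall>z\<in>frontier \<Omega>. u z = \<phi> z)"

end

theory Submission
  imports Defs "HOL-Complex_Analysis.Complex_Analysis" "HOL-Real_Asymp.Real_Asymp"
begin

text \<open>
  Write \<open>\<partial>\<close> for the \<open>z\<close>-derivative. If \<open>\<phi>\<close> is a polynomial vanishing on the boundary, \<open>\<partial>\<phi>\<close> is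
  orthogonal to the Bergman space, by integration by parts. Given \<open>q\<close>, pick \<open>Q\<close> with \<open>\<partial>Q = q\<close>
  and let \<open>u\<close> be the polynomial solution of the Dirichlet problem for \<open>Q\<close>: then \<open>\<partial>u\<close> is holomorphic and
  \<open>q - \<partial>u = \<partial>(Q - u)\<close> is orthogonal to the Bergman space, so \<open>\<partial>u\<close> is the projection of \<open>q\<close>.

  Conversely, let \<open>p\<close> be the projection of \<open>\<partial>Q\<close>, a polynomial in \<open>z\<close>, and let \<open>R' = p\<close>. Since \<open>\<partial>Q - p\<close>
  is orthogonal to \<open>1 / (\<zeta> - z)\<close> for every exterior point \<open>\<zeta>\<close>, the Cauchy transform of its conjugate vanishes
  outside \<open>\<Omega>\<close>, hence on the boundary. Subtracting it shows that \<open>Q - R\<close> has the boundary values of an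
  antiholomorphic function. The same holds for the conjugate of \<open>Q\<close>, with another polynomial \<open>R\<^sub>2\<close>;
  comparing the two harmonic extensions of \<open>Q\<close> shows that both are \<open>R + cnj R\<^sub>2\<close> up to a constant.
\<close>

section \<open>Wirtinger derivatives and polynomials\<close>

text \<open>No boundary integral and no Green formula occurs. The only integration by parts is that
  derivatives of a compactly supported C^1 function have integral 0, a consequence of translation
  invariance. A Bergman function has no boundary values, so it is paired with a cutoff of \<phi>
  that vanishes near the boundary. The cutoff has the right limiting slope only where \<phi> is
  nonzero, hence the separate result that the gradient of \<phi> vanishes almost everywhere on its
  zero set.

  Smoothness of the boundary is used through one fact: each boundary point is a limit of exterior
  points, as fails for a slit disc. This carries the vanishing of the Cauchy transform from the
  exterior to the boundary.

  One application of the projection only gives a harmonic extension R + cnj A with an unknown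
  holomorphic A. The application to the conjugate of Q gives an extension whose antiholomorphic part
  is a polynomial, and uniqueness of the splitting up to a constant joins the two polynomial
  halves.\<close>

definition has_wirtinger :: "(complex \<Rightarrow> complex) \<Rightarrow> complex \<Rightarrow> complex \<Rightarrow> complex \<Rightarrow> bool" where
  "has_wirtinger f a b z \<longleftrightarrow> (f has_derivative (\<lambda>h. a * h + b * cnj h)) (at z)"

lemma has_wirtinger_const: "has_wirtinger (\<lambda>_. c) 0 0 z"
  by (simp add: has_wirtinger_def)

lemma has_wirtinger_add:
  "has_wirtinger f a b z \<Longrightarrow> has_wirtinger g c d z \<Longrightarrow> has_wirtinger (\<lambda>z. f z + g z) (a + c) (b + d) z"
  unfolding has_wirtinger_def
  by (rule derivative_eq_intros | assumption | rule ext, simp add: algebra_simps)+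

lemma has_wirtinger_diff:
  "has_wirtinger f a b z \<Longrightarrow> has_wirtinger g c d z \<Longrightarrow> has_wirtinger (\<lambda>z. f z - g z) (a - c) (b - d) z"
  unfolding has_wirtinger_def
  by (rule derivative_eq_intros | assumption | rule ext, simp add: algebra_simps)+

lemma has_wirtinger_mult:
  "has_wirtinger f a b z \<Longrightarrow> has_wirtinger g c d z \<Longrightarrow>
    has_wirtinger (\<lambda>z. f z * g z) (a * g z + f z * c) (b * g z + f z * d) z"
  unfolding has_wirtinger_def
  by (rule derivative_eq_intros | assumption | rule ext, simp add: algebra_simps)+

lemma has_wirtinger_cnj:
  "has_wirtinger f a b z \<Longrightarrow> has_wirtinger (\<lambda>z. cnj (f z)) (cnj b) (cnj a) z"
  unfolding has_wirtinger_def
  by (rule derivative_eq_intros | assumption | rule ext, simp add: algebra_simps)+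

lemma has_wirtinger_of_field_derivative:
  "(f has_field_derivative a) (at z) \<Longrightarrow> has_wirtinger f a 0 z"
  by (simp add: has_wirtinger_def has_field_derivative_def)

lemma has_wirtinger_imp_field_derivative:
  "has_wirtinger f a 0 z \<Longrightarrow> (f has_field_derivative a) (at z)"
  by (simp add: has_wirtinger_def has_field_derivative_def)

lemma has_wirtinger_cong_open:
  "has_wirtinger f a b z \<Longrightarrow> open S \<Longrightarrow> z \<in> S \<Longrightarrow> (\<And>w. w \<in> S \<Longrightarrow> g w = f w) \<Longrightarrow> has_wirtinger g a b z"
  unfolding has_wirtinger_def by (rule has_derivative_transform_within_open[of f]) auto

lemma has_wirtinger_isCont: "has_wirtinger f a b z \<Longrightarrow> isCont f z"
  unfolding has_wirtinger_def by (rule has_derivative_continuous)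

text \<open>The pair \<open>a\<close>, \<open>cnj a\<close> makes the derivative h -> 2 Re (a h),
  which is real; it is therefore also the derivative of Re f, and the one-variable chain rule
  applies.\<close>

lemma has_wirtinger_real_compose:
  assumes "has_wirtinger f a (cnj a) z" "(F has_real_derivative D) (at (Re (f z)))"
  shows "has_wirtinger (\<lambda>z. of_real (F (Re (f z)))) (of_real D * a) (of_real D * cnj a) z"
proof -
  have "((\<lambda>z. Re (f z)) has_derivative (\<lambda>h. Re (a * h + cnj a * cnj h))) (at z)"
    using assms(1) unfolding has_wirtinger_def by (rule has_derivative_Re)
  then have "((\<lambda>z. F (Re (f z))) has_derivative (\<lambda>h. D * Re (a * h + cnj a * cnj h))) (at z)"
    using has_derivative_compose[of "\<lambda>z. Re (f z)" _ z UNIV F "(*) D"] assms(2)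
    by (simp add: has_field_derivative_def)
  then have "((\<lambda>z. complex_of_real (F (Re (f z)))) has_derivative
      (\<lambda>h. of_real (D * Re (a * h + cnj a * cnj h)))) (at z)"
    by (rule has_derivative_of_real)
  moreover have "(\<lambda>h. complex_of_real (D * Re (a * h + cnj a * cnj h))) =
      (\<lambda>h. of_real D * a * h + of_real D * cnj a * cnj h)"
    by (rule ext) (simp add: complex_eq_iff algebra_simps)
  ultimately show ?thesis by (simp add: has_wirtinger_def)
qed

lemma has_wirtinger_norm_sq: "has_wirtinger (\<lambda>z. of_real ((cmod z)\<^sup>2)) (cnj z) z z"
proof -
  have "has_wirtinger (\<lambda>z. z * cnj z) (1 * cnj z + z * cnj 0) (0 * cnj z + z * cnj 1) z"
    by (intro has_wirtinger_mult has_wirtinger_cnj has_wirtinger_of_field_derivative) auto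
  then show ?thesis by (simp add: complex_norm_square del: of_real_power)
qed

text \<open>Radial functions are expressed through the squared modulus, since the modulus itself is
  not differentiable at 0.\<close>

lemma has_wirtinger_norm_sq_compose:
  assumes "(F has_real_derivative D) (at ((cmod z)\<^sup>2))"
  shows "has_wirtinger (\<lambda>z. of_real (F ((cmod z)\<^sup>2))) (of_real D * cnj z) (of_real D * z) z"
  using has_wirtinger_real_compose[of "\<lambda>z. of_real ((cmod z)\<^sup>2)" "cnj z" z F D]
    has_wirtinger_norm_sq[of z] assms by simp

section \<open>Polynomials in z and its conjugate\<close>

lemma polynomial_function_Re_Im:
  fixes f :: "complex \<Rightarrow> complex"
  shows "polynomial_function f \<longleftrightarrow>
    real_polynomial_function (\<lambda>z. Re (f z)) \<and> real_polynomial_function (\<lambda>z. Im (f z))"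
  using polynomial_function_iff_Basis_inner[of f] by (simp add: Basis_complex_def inner_complex_def)

lemma polynomial_function_times:
  fixes f g :: "complex \<Rightarrow> complex"
  shows "polynomial_function f \<Longrightarrow> polynomial_function g \<Longrightarrow> polynomial_function (\<lambda>z. f z * g z)"
  by (auto simp: polynomial_function_Re_Im)

lemma polynomial_function_power:
  fixes f :: "complex \<Rightarrow> complex"
  shows "polynomial_function f \<Longrightarrow> polynomial_function (\<lambda>z. f z ^ n)"
  by (induction n) (auto intro: polynomial_function_times)

lemma polynomial_function_cnj:
  fixes f :: "complex \<Rightarrow> complex"
  shows "polynomial_function f \<Longrightarrow> polynomial_function (\<lambda>z. cnj (f z))"
  by (auto simp: polynomial_function_Re_Im)

lemma polynomial_function_monom:
  fixes c :: complex
  shows "polynomial_function (\<lambda>z. c * z ^ m * cnj z ^ n)"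
  by (intro polynomial_function_times polynomial_function_power polynomial_function_cnj) auto

lemma polynomial_function_poly: "polynomial_function (poly (P :: complex poly))"
  by (induction P) (auto intro: polynomial_function_times)

text \<open>The finite sums of monomials in z and cnj z form an algebra containing every real-linear
  functional, hence all polynomial functions. Products thus disappear from the induction: a property
  compatible with sums is checked on monomials alone.\<close>

lemma polynomial_function_induct [consumes 1, case_names monom add]:
  fixes f :: "complex \<Rightarrow> complex"
  assumes "polynomial_function f"
    and monom: "\<And>c m n. P (\<lambda>z. c * z ^ m * cnj z ^ n)"
    and add: "\<And>f g. polynomial_function f \<Longrightarrow> polynomial_function g \<Longrightarrow> P f \<Longrightarrow> P g \<Longrightarrow> P (\<lambda>z. f z + g z)"
  shows "P f"
proof -
  define ev :: "(nat \<times> nat) set \<Rightarrow> (nat \<Rightarrow> nat \<Rightarrow> complex) \<Rightarrow> complex \<Rightarrow> complex"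
    where "ev I a z = (\<Sum>(m,n)\<in>I. a m n * z ^ m * cnj z ^ n)" for I a z
  define S where "S = {ev I a | I a. finite I}"
  have S_I: "ev I a \<in> S" if "finite I" for I a
    using that unfolding S_def by blast
  have S_E: "\<exists>I a. finite I \<and> f = ev I a" if "f \<in> S" for f
    using that unfolding S_def by blast
  have S_monom: "(\<lambda>z. c * z ^ m * cnj z ^ n) \<in> S" for c m n
  proof -
    have "(\<lambda>z. c * z ^ m * cnj z ^ n) = ev {(m,n)} (\<lambda>_ _. c)"
      by (simp add: ev_def fun_eq_iff)
    then show ?thesis using S_I by simp
  qed
  have S_add: "(\<lambda>z. f z + g z) \<in> S" if fS: "f \<in> S" and gS: "g \<in> S" for f g
  proof -
    obtain I a J b where IJ: "finite I" "finite J"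
      and f: "f = ev I a" and g: "g = ev J b"
      using S_E[OF fS] S_E[OF gS] by blast
    \<comment> \<open>Both coefficient families are extended by 0 to the common index set
      \<open>I \<union> J\<close>.\<close>
    define e where "e m n = (if (m,n) \<in> I then a m n else 0) + (if (m,n) \<in> J then b m n else 0)" for m n
    have "f z = (\<Sum>(m,n)\<in>I\<union>J. (if (m,n) \<in> I then a m n else 0) * z ^ m * cnj z ^ n)" for z
      unfolding f ev_def by (rule sum.mono_neutral_cong_left) (use IJ in auto)
    moreover have "g z = (\<Sum>(m,n)\<in>I\<union>J. (if (m,n) \<in> J then b m n else 0) * z ^ m * cnj z ^ n)" for z
      unfolding g ev_def by (rule sum.mono_neutral_cong_left) (use IJ in auto)
    ultimately have "(\<lambda>z. f z + g z) = ev (I \<union> J) e"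
      by (simp add: fun_eq_iff ev_def e_def sum.distrib[symmetric] case_prod_unfold algebra_simps)
    then show ?thesis using IJ S_I by simp
  qed
  have S_sum: "(\<lambda>z. \<Sum>i\<in>I. F i z) \<in> S" if "finite I" "\<And>i. i \<in> I \<Longrightarrow> F i \<in> S" for I and F :: "nat \<times> nat \<Rightarrow> _"
    using that by (induction I) (use S_monom[of 0 0 0] S_add in auto)
  have S_mm: "(\<lambda>z. f z * (c * z ^ m * cnj z ^ n)) \<in> S" if f: "f \<in> S" for f c m n
  proof -
    obtain I a where "finite I" and f: "f = ev I a"
      using S_E[OF f] by blast
    then have "(\<lambda>z. f z * (c * z ^ m * cnj z ^ n)) =
        (\<lambda>z. \<Sum>i\<in>I. (a (fst i) (snd i) * c) * z ^ (fst i + m) * cnj z ^ (snd i + n))"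
      by (simp add: ev_def sum_distrib_left sum_distrib_right power_add algebra_simps case_prod_unfold)
    also have "\<dots> \<in> S" by (rule S_sum) (use \<open>finite I\<close> S_monom in auto)
    finally show ?thesis .
  qed
  have S_mult: "(\<lambda>z. f z * g z) \<in> S" if f: "f \<in> S" and g: "g \<in> S" for f g
  proof -
    obtain I a where "finite I" and "g = ev I a"
      using S_E[OF g] by blast
    then have "(\<lambda>z. f z * g z) =
        (\<lambda>z. \<Sum>i\<in>I. f z * (a (fst i) (snd i) * z ^ (fst i) * cnj z ^ (snd i)))"
      by (simp add: ev_def sum_distrib_left case_prod_unfold)
    also have "\<dots> \<in> S" by (rule S_sum) (use \<open>finite I\<close> S_mm f in auto)
    finally show ?thesis .
  qed
  have S_real: "(\<lambda>z. of_real (r z)) \<in> S" if "real_polynomial_function r" for r :: "complex \<Rightarrow> real"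
    using that
  proof (induction r rule: real_polynomial_function.induct)
    case (linear f)
    interpret bounded_linear f by fact
    \<comment> \<open>Substitute x = (z + cnj z) / 2 and y = (z - cnj z) / (2 i) in x f(1) + y
      f(i).\<close>
    have eq: "complex_of_real (f z) = (of_real (f 1) - \<i> * of_real (f \<i>)) / 2 * z ^ 1 * cnj z ^ 0
        + (of_real (f 1) + \<i> * of_real (f \<i>)) / 2 * z ^ 0 * cnj z ^ 1" for z
    proof -
      have "z = Re z *\<^sub>R 1 + Im z *\<^sub>R \<i>" by (simp add: complex_eq_iff)
      then have "f z = f (Re z *\<^sub>R 1 + Im z *\<^sub>R \<i>)" by simp
      also have "\<dots> = Re z * f 1 + Im z * f \<i>" by (simp only: add scaleR real_scaleR_def)
      finally show ?thesis by (simp add: complex_eq_iff field_simps)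
    qed
    have "(\<lambda>z. complex_of_real (f z)) = (\<lambda>z. (of_real (f 1) - \<i> * of_real (f \<i>)) / 2 * z ^ 1 * cnj z ^ 0
        + (of_real (f 1) + \<i> * of_real (f \<i>)) / 2 * z ^ 0 * cnj z ^ 1)"
      by (rule ext) (rule eq)
    also have "\<dots> \<in> S" by (intro S_add S_monom)
    finally show ?case .
  next
    case (const c)
    then show ?case using S_monom[of "of_real c" 0 0] by simp
  qed (auto intro: S_add S_mult)
  have "f = (\<lambda>z. of_real (Re (f z)) + (\<i> * z ^ 0 * cnj z ^ 0) * of_real (Im (f z)))"
    by (auto simp: complex_eq_iff)
  also have "\<dots> \<in> S"
    by (intro S_add S_mult S_real S_monom) (use assms(1) polynomial_function_Re_Im in auto)
  finally obtain I a where I: "finite I" and f: "f = ev I a"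
    using S_E by blast
  \<comment> \<open>Polynomiality is carried along because the hypothesis \<open>add\<close> asks
    for it of both summands.\<close>
  have "polynomial_function (ev I a) \<and> P (ev I a)"
    using I
  proof induction
    case empty
    then show ?case using monom[of 0 0 0] polynomial_function_const[of 0]
      by (simp add: ev_def[abs_def])
  next
    case (insert x I)
    have "ev (insert x I) a = (\<lambda>z. a (fst x) (snd x) * z ^ fst x * cnj z ^ snd x + ev I a z)"
      using insert by (simp add: fun_eq_iff ev_def case_prod_unfold)
    then show ?case
      using insert add[OF polynomial_function_monom _ monom] polynomial_function_monom polynomial_function_add
      by metis
  qed
  then show ?thesis by (simp add: f)
qed

lemma has_wirtinger_monom:
  "has_wirtinger (\<lambda>z. c * z ^ m * cnj z ^ n)
    (c * of_nat m * z ^ (m - 1) * cnj z ^ n) (c * of_nat n * z ^ m * cnj z ^ (n - 1)) z"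
proof -
  have "has_wirtinger (\<lambda>z. (c * z ^ m) * cnj (z ^ n))
     ((c * (of_nat m * z ^ (m - 1))) * cnj (z ^ n) + (c * z ^ m) * cnj 0)
     (0 * cnj (z ^ n) + (c * z ^ m) * cnj (of_nat n * z ^ (n - 1))) z"
    by (intro has_wirtinger_mult has_wirtinger_cnj has_wirtinger_of_field_derivative)
      (auto intro!: derivative_eq_intros)
  then show ?thesis by (simp add: mult_ac)
qed

text \<open>The single function \<open>s\<close> for both mixed derivatives records the symmetry of
  second derivatives; for a monomial this is the commutation of the factors m and n. The Laplacian
  of \<open>f\<close> is then 4 \<open>s\<close>.\<close>

lemma polynomial_function_wirtinger2:
  fixes f :: "complex \<Rightarrow> complex"
  assumes "polynomial_function f"
  obtains p q r s t where "polynomial_function p" "polynomial_function q"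
    "polynomial_function r" "polynomial_function s" "polynomial_function t"
    "\<And>z. has_wirtinger f (p z) (q z) z" "\<And>z. has_wirtinger p (r z) (s z) z"
    "\<And>z. has_wirtinger q (s z) (t z) z"
proof -
  define W where "W f p q r s t \<longleftrightarrow> polynomial_function p \<and> polynomial_function q \<and>
    polynomial_function r \<and> polynomial_function s \<and> polynomial_function t \<and>
    (\<forall>z. has_wirtinger f (p z) (q z) z) \<and> (\<forall>z. has_wirtinger p (r z) (s z) z) \<and>
    (\<forall>z. has_wirtinger q (s z) (t z) z)" for f p q r s t :: "complex \<Rightarrow> complex"
  have "\<exists>p q r s t. W f p q r s t"
    using assms
  proof (induction rule: polynomial_function_induct)
    case (monom c m n)
    have *: "c * of_nat n * of_nat m * z ^ (m - 1) * cnj z ^ (n - 1) =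
        c * of_nat m * of_nat n * z ^ (m - 1) * cnj z ^ (n - 1)" for z
      by simp
    show ?case
      unfolding W_def
      by (rule exI conjI allI has_wirtinger_monom polynomial_function_monom)+
        (subst *[symmetric], rule has_wirtinger_monom)
  next
    case (add f g)
    obtain p q r s t where 1: "W f p q r s t" using add.IH(1) by blast
    obtain p' q' r' s' t' where 2: "W g p' q' r' s' t'" using add.IH(2) by blast
    have "W (\<lambda>z. f z + g z) (\<lambda>z. p z + p' z) (\<lambda>z. q z + q' z) (\<lambda>z. r z + r' z)
        (\<lambda>z. s z + s' z) (\<lambda>z. t z + t' z)"
      using 1 2 unfolding W_def by (auto intro: has_wirtinger_add)
    then show ?case by blast
  qed
  then obtain p q r s t where "W f p q r s t" by blast
  then show thesis by (intro that[of p q r s t]) (auto simp: W_def)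
qed

lemma polynomial_function_wirtinger:
  fixes f :: "complex \<Rightarrow> complex"
  assumes "polynomial_function f"
  obtains p q where "polynomial_function p" "polynomial_function q"
    "\<And>z. has_wirtinger f (p z) (q z) z"
  using polynomial_function_wirtinger2[OF assms] by metis

lemma polynomial_function_antiderivative:
  fixes q :: "complex \<Rightarrow> complex"
  assumes "polynomial_function q"
  obtains Q q' where "polynomial_function Q" "polynomial_function q'"
    "\<And>z. has_wirtinger Q (q z) (q' z) z"
proof -
  have "\<exists>Q q'. polynomial_function Q \<and> polynomial_function q' \<and> (\<forall>z. has_wirtinger Q (q z) (q' z) z)"
    using assms
  proof (induction rule: polynomial_function_induct)
    case (monom c m n)
    have "\<forall>z. has_wirtinger (\<lambda>z. c / of_nat (Suc m) * z ^ Suc m * cnj z ^ n)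
       (c * z ^ m * cnj z ^ n) (c / of_nat (Suc m) * of_nat n * z ^ Suc m * cnj z ^ (n - 1)) z"
      using has_wirtinger_monom[of "c / of_nat (Suc m)" "Suc m" n] by (simp del: of_nat_Suc power_Suc)
    then show ?case
      using polynomial_function_monom[of "c / of_nat (Suc m)" "Suc m" n]
        polynomial_function_monom[of "c / of_nat (Suc m) * of_nat n" "Suc m" "n - 1"] by blast
  next
    case (add f g)
    then obtain F f' G g' where "polynomial_function F" "polynomial_function f'"
      "polynomial_function G" "polynomial_function g'" "\<And>z. has_wirtinger F (f z) (f' z) z"
      "\<And>z. has_wirtinger G (g z) (g' z) z"
      by metis
    then show ?case
      by (intro exI[of _ "\<lambda>z. F z + G z"] exI[of _ "\<lambda>z. f' z + g' z"])
        (auto intro: has_wirtinger_add)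
  qed
  then show thesis by (elim exE conjE) (rule that; blast)
qed

lemma poly_antiderivative:
  fixes P :: "complex poly"
  obtains R where "pderiv R = P"
proof
  show "pderiv (\<Sum>i\<le>degree P. monom (coeff P i / of_nat (Suc i)) (Suc i)) = P"
    by (subst (2) poly_as_sum_of_monoms[symmetric])
      (simp add: higher_pderiv_sum[where n = 1, simplified] pderiv_monom del: of_nat_Suc)
qed

text \<open>On the horizontal line through \<open>a\<close> one has cnj z = z + (cnj a - a), so
  conjugates can be eliminated in favour of z.\<close>

lemma polynomial_function_horizontal:
  fixes f :: "complex \<Rightarrow> complex"
  assumes "polynomial_function f"
  obtains P :: "complex poly" where "\<And>t::real. f (a + of_real t) = poly P (a + of_real t)"
proof -
  have "\<exists>P :: complex poly. \<forall>t::real. f (a + of_real t) = poly P (a + of_real t)"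
    using assms
  proof (induction rule: polynomial_function_induct)
    case (monom c m n)
    show ?case
      by (rule exI[of _ "[:c:] * [:0, 1:] ^ m * [:cnj a - a, 1:] ^ n"]) (simp add: algebra_simps)
  next
    case (add f g)
    then show ?case by (metis poly_add)
  qed
  then show thesis by (elim exE conjE) (rule that; blast)
qed

text \<open>Identity theorem: \<open>p\<close> agrees with a polynomial in z on a horizontal segment
  that accumulates at a point of \<open>S\<close>.\<close>

lemma holomorphic_polynomial_function_eq_poly:
  assumes "polynomial_function p" "p holomorphic_on S" "open S" "connected S"
  obtains P :: "complex poly" where "\<And>z. z \<in> S \<Longrightarrow> p z = poly P z"
proof (cases "S = {}")
  case False
  then obtain a where a: "a \<in> S" by blast
  then obtain e where e: "e > 0" "ball a e \<subseteq> S" using \<open>open S\<close> openE by blast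
  obtain P where P: "\<And>t::real. p (a + of_real t) = poly P (a + of_real t)"
    using polynomial_function_horizontal[OF assms(1)] by blast
  define U where "U = (\<lambda>t::real. a + of_real t) ` {0<..<e}"
  have "U \<subseteq> S" using e by (auto simp: U_def dist_norm)
  have lim: "a islimpt U"
  proof (rule islimptI)
    fix T assume "a \<in> T" "open T"
    then obtain d where d: "d > 0" "ball a d \<subseteq> T" using openE by blast
    define t where "t = min d e / 2"
    have t: "0 < t" "t < d" "t < e" using d e by (auto simp: t_def)
    then have "a + of_real t \<in> U" by (auto simp: U_def)
    moreover have "a + of_real t \<in> T" using t d by (auto simp: dist_norm)
    moreover have "a + of_real t \<noteq> a" using t by simp
    ultimately show "\<exists>y\<in>U. y \<in> T \<and> y \<noteq> a" by blast
  qed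
  have U0: "p z - poly P z = 0" if "z \<in> U" for z using that P by (auto simp: U_def)
  have hol: "(\<lambda>z. p z - poly P z) holomorphic_on S"
    by (intro holomorphic_intros assms)
  have "p z - poly P z = 0" if "z \<in> S" for z
    using analytic_continuation[OF hol assms(3,4) \<open>U \<subseteq> S\<close> a lim U0 that] .
  then show thesis by (intro that[of P]) simp
next
  case True
  then show thesis by (intro that[of 0]) simp
qed

section \<open>Differentiation of convolutions\<close>

lemma lborel_integral_reflect:
  fixes f :: "complex \<Rightarrow> complex"
  shows "(LINT z|lborel. f (w - z)) = (LINT z|lborel. f z)"
proof (cases "f \<in> borel_measurable borel")
  case True
  have "(LINT z|lborel. f z) = (LINT z|density (distr lborel borel (\<lambda>z. w + (-1) *\<^sub>R z)) (\<lambda>_. ennreal (\<bar>-1\<bar>^DIM(complex))). f z)"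
    by (subst lborel_affine[of "-1" w]) auto
  also have "\<dots> = (LINT z|distr lborel borel (\<lambda>z. w + (-1) *\<^sub>R z). f z)"
    by (simp add: density_1)
  also have "\<dots> = (LINT z|lborel. f (w - z))"
    using True by (subst integral_distr) auto
  finally show ?thesis by simp
next
  \<comment> \<open>Without measurability neither integrand is integrable, and both integrals take
    the default value 0.\<close>
  case False
  have "(\<lambda>z. f (w - z)) \<notin> borel_measurable borel"
  proof
    assume "(\<lambda>z. f (w - z)) \<in> borel_measurable borel"
    then have "(\<lambda>z. (\<lambda>z. f (w - z)) (w - z)) \<in> borel_measurable borel"
      by (rule measurable_compose[rotated]) auto
    then show False using False by simp
  qed
  then have "\<not> integrable lborel (\<lambda>z. f (w - z))" "\<not> integrable lborel f"
    using False by (auto dest: borel_measurable_integrable)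
  then show ?thesis by (simp add: not_integrable_integral_eq)
qed

lemma norm_wirtinger_le: "cmod (a * h + b * cnj h) \<le> (cmod a + cmod b) * cmod h"
  by (rule order_trans[OF norm_triangle_ineq]) (simp add: norm_mult algebra_simps)

lemma integrable_convolution:
  fixes g :: "complex \<Rightarrow> complex"
  assumes g: "continuous_on UNIV g"
    and w: "integrable lborel w" and supp: "\<And>z. R < cmod z \<Longrightarrow> w z = 0"
  shows "integrable lborel (\<lambda>z. w z * g (\<zeta> - z))"
proof -
  have "compact ((\<lambda>z. g (\<zeta> - z)) ` cball 0 R)"
    by (intro compact_continuous_image continuous_on_compose2[OF g] continuous_intros) auto
  then obtain B where B: "\<And>z. z \<in> cball 0 R \<Longrightarrow> cmod (g (\<zeta> - z)) \<le> B"
    by (meson bounded_iff compact_imp_bounded image_eqI)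
  have [measurable]: "g \<in> borel_measurable borel" using g borel_measurable_continuous_onI by blast
  have [measurable]: "w \<in> borel_measurable borel" using w by simp
  show ?thesis
  proof (rule Bochner_Integration.integrable_bound)
    show "integrable lborel (\<lambda>z. B * w z)" using w by simp
    have "cmod (w z * g (\<zeta> - z)) \<le> cmod (B * w z)" for z
      using mult_right_mono[OF order_trans[OF B[of z] abs_ge_self[of B]], of "cmod (w z)"] supp[of z]
      by (cases "cmod z \<le> R") (auto simp: norm_mult mult.commute)
    then show "AE z in lborel. cmod (w z * g (\<zeta> - z)) \<le> cmod (B * w z)" by simp
  qed measurable
qed

text \<open>Uniform continuity of \<open>a\<close> and \<open>b\<close> on a compact set bounds the
  first-order remainder of \<open>K\<close> uniformly in the integration variable; this bound is
  integrated against |w|. The bounded support of \<open>w\<close> keeps the arguments of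
  \<open>K\<close> in a compact set.\<close>

lemma has_wirtinger_convolution:
  assumes K: "\<And>z. has_wirtinger K (a z) (b z) z"
    and a: "continuous_on UNIV a" and b: "continuous_on UNIV b"
    and w: "integrable lborel w" and supp: "\<And>z. R < cmod z \<Longrightarrow> w z = 0"
  shows "has_wirtinger (\<lambda>\<zeta>. LINT z|lborel. w z * K (\<zeta> - z))
    (LINT z|lborel. w z * a (\<zeta> - z)) (LINT z|lborel. w z * b (\<zeta> - z)) \<zeta>"
proof -
  have K_cont: "continuous_on UNIV K"
    using K[THEN has_wirtinger_isCont] by (auto simp: continuous_on_eq_continuous_at)
  note int = integrable_convolution[OF _ w supp]
  define Da where "Da = (LINT z|lborel. w z * a (\<zeta> - z))"
  define Db where "Db = (LINT z|lborel. w z * b (\<zeta> - z))"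
  define F where "F \<zeta> = (LINT z|lborel. w z * K (\<zeta> - z))" for \<zeta>
  define M where "M = (LINT z|lborel. cmod (w z))"
  have M: "M \<ge> 0" by (simp add: M_def)
  have wn: "integrable lborel (\<lambda>z. cmod (w z))" using w by simp
  have "(F has_derivative (\<lambda>h. Da * h + Db * cnj h)) (at \<zeta>)"
    unfolding has_derivative_at_alt
  proof (intro conjI allI impI)
    show "bounded_linear (\<lambda>h. Da * h + Db * cnj h)"
      by (intro bounded_linear_add bounded_linear_mult_right bounded_linear_compose[OF bounded_linear_mult_right] bounded_linear_cnj)
  next
    fix e :: real assume e: "e > 0"
    \<comment> \<open>Each of the two coefficients contributes \<open>e'\<close>; M + 1 keeps the
      denominator positive when M = 0.\<close>
    define e' where "e' = e / (2 * (M + 1))"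
    have e': "e' > 0" and e'M: "2 * e' * M \<le> e" using e M by (auto simp: e'_def field_simps)
    \<comment> \<open>Contains \<zeta> - z for |z| \<le> R together with all increments of length
      below 1.\<close>
    define C where "C = cball (0::complex) (R + cmod \<zeta> + 1)"
    have "uniformly_continuous_on C a" "uniformly_continuous_on C b"
      using a b by (auto simp: C_def intro!: compact_uniformly_continuous continuous_on_subset[of UNIV])
    then obtain d1 d2 where d: "d1 > 0" "d2 > 0"
      and d1: "\<And>x y. x \<in> C \<Longrightarrow> y \<in> C \<Longrightarrow> dist y x < d1 \<Longrightarrow> dist (a y) (a x) < e'"
      and d2: "\<And>x y. x \<in> C \<Longrightarrow> y \<in> C \<Longrightarrow> dist y x < d2 \<Longrightarrow> dist (b y) (b x) < e'"
      unfolding uniformly_continuous_on_def using e' by metis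
    define d where "d = min 1 (min d1 d2)"
    have key: "cmod (K (x + h) - K x - (a x * h + b x * cnj h)) \<le> 2 * e' * cmod h"
      if x: "cmod x \<le> R + cmod \<zeta>" and h: "cmod h < d" for x h
    proof -
      \<comment> \<open>Subtracting the linear part taken at \<open>x\<close> leaves a function
        whose derivative is small on the ball, so the mean value inequality applies.\<close>
      define G where "G y = K y - (a x * y + b x * cnj y)" for y
      have "cmod (G (x + h) - G x) \<le> 2 * e' * cmod (x + h - x)"
      proof (rule differentiable_bound[where S = "ball x d"])
        fix y assume y: "y \<in> ball x d"
        have xC: "x \<in> C" using x by (simp add: C_def)
        have "cmod y \<le> cmod x + dist x y"
          by (metis dist_norm norm_minus_commute norm_triangle_sub)
        then have yC: "y \<in> C" using y x by (simp add: C_def d_def)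
        have "has_wirtinger (\<lambda>y. a x * y + b x * cnj y) (a x) (b x) y"
          unfolding has_wirtinger_def by (rule derivative_eq_intros | rule ext, simp)+
        with K[of y] have "has_wirtinger G (a y - a x) (b y - b x) y"
          unfolding G_def by (rule has_wirtinger_diff)
        then show "(G has_derivative (\<lambda>h. (a y - a x) * h + (b y - b x) * cnj h)) (at y within ball x d)"
          unfolding has_wirtinger_def by (rule has_derivative_at_withinI)
        have "cmod (a y - a x) + cmod (b y - b x) \<le> 2 * e'"
          using d1[OF xC yC] d2[OF xC yC] y by (simp add: dist_norm norm_minus_commute d_def)
        then show "onorm (\<lambda>h. (a y - a x) * h + (b y - b x) * cnj h) \<le> 2 * e'"
          by (intro onorm_le order_trans[OF norm_wirtinger_le] mult_right_mono) auto
      qed (use h d in \<open>auto simp: dist_norm d_def\<close>)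
      also have "G (x + h) - G x = K (x + h) - K x - (a x * h + b x * cnj h)"
        by (simp add: G_def algebra_simps)
      finally show ?thesis by simp
    qed
    show "\<exists>d>0. \<forall>y. cmod (y - \<zeta>) < d \<longrightarrow>
        cmod (F y - F \<zeta> - (Da * (y - \<zeta>) + Db * cnj (y - \<zeta>))) \<le> e * cmod (y - \<zeta>)"
    proof (intro exI[of _ d] conjI allI impI)
      fix y assume y: "cmod (y - \<zeta>) < d"
      define h where "h = y - \<zeta>"
      let ?g = "\<lambda>z. w z * K (y - z) - w z * K (\<zeta> - z) - (w z * a (\<zeta> - z) * h + w z * b (\<zeta> - z) * cnj h)"
      have diff_eq: "F y - F \<zeta> - (Da * h + Db * cnj h) = (LINT z|lborel. ?g z)"
        using int[OF K_cont] int[OF a] int[OF b] by (simp add: F_def Da_def Db_def)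
      have "cmod (F y - F \<zeta> - (Da * h + Db * cnj h)) \<le> (LINT z|lborel. cmod (?g z))"
        unfolding diff_eq by (rule integral_norm_bound)
      also have "\<dots> \<le> (LINT z|lborel. 2 * e' * cmod h * cmod (w z))"
      proof (rule integral_mono)
        show "integrable lborel (\<lambda>z. cmod (?g z))"
          by (intro integrable_norm Bochner_Integration.integrable_diff Bochner_Integration.integrable_add
              integrable_mult_left int[OF K_cont, where \<zeta> = y] int[OF K_cont, where \<zeta> = \<zeta>] int[OF a, where \<zeta> = \<zeta>] int[OF b, where \<zeta> = \<zeta>])
        show "integrable lborel (\<lambda>z. 2 * e' * cmod h * cmod (w z))" using wn by simp
        fix z
        show "cmod (?g z) \<le> 2 * e' * cmod h * cmod (w z)"
        proof (cases "cmod z \<le> R")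
          case True
          have "cmod (\<zeta> - z) \<le> R + cmod \<zeta>" using True norm_triangle_ineq4[of \<zeta> z] by simp
          from key[OF this, of h] y
          have "cmod (K (y - z) - K (\<zeta> - z) - (a (\<zeta> - z) * h + b (\<zeta> - z) * cnj h)) \<le> 2 * e' * cmod h"
            by (simp add: h_def algebra_simps)
          then have "cmod (w z) * cmod (K (y - z) - K (\<zeta> - z) - (a (\<zeta> - z) * h + b (\<zeta> - z) * cnj h))
              \<le> cmod (w z) * (2 * e' * cmod h)"
            by (rule mult_left_mono) simp
          moreover have "?g z = w z * (K (y - z) - K (\<zeta> - z) - (a (\<zeta> - z) * h + b (\<zeta> - z) * cnj h))"
            by (simp add: algebra_simps)
          ultimately show ?thesis by (simp only: norm_mult mult.commute mult.left_commute)
        qed (use supp[of z] in auto)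
      qed
      also have "\<dots> = (2 * e' * M) * cmod h" by (simp add: M_def)
      also have "\<dots> \<le> e * cmod h" using e'M by (intro mult_right_mono) auto
      finally show "cmod (F y - F \<zeta> - (Da * (y - \<zeta>) + Db * cnj (y - \<zeta>))) \<le> e * cmod (y - \<zeta>)"
        by (simp add: h_def)
    qed (use d in \<open>auto simp: d_def\<close>)
  qed
  then show ?thesis by (simp add: has_wirtinger_def F_def[abs_def] Da_def Db_def)
qed

lemma has_wirtinger_locally_constant:
  assumes "has_wirtinger f a b z" "open S" "z \<in> S" "\<And>w. w \<in> S \<Longrightarrow> f w = c"
  shows "a = 0" "b = 0"
proof -
  have "has_wirtinger f 0 0 z"
    by (rule has_wirtinger_cong_open[OF has_wirtinger_const[of c] assms(2,3)]) (use assms in auto)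
  then have "(\<lambda>h. a * h + b * cnj h) = (\<lambda>h. 0 * h + 0 * cnj h)"
    using assms(1) unfolding has_wirtinger_def by (rule has_derivative_unique[rotated])
  from fun_cong[OF this, of 1] fun_cong[OF this, of \<i>] show "a = 0" "b = 0"
    by (auto simp: complex_eq_iff)
qed

text \<open>Near 0 the convolution of \<open>f\<close> with the indicator of a large disc is
  constant, equal to the integral of \<open>f\<close> by translation and reflection invariance.
  Differentiating under the integral yields the integrals of \<open>a\<close> and \<open>b\<close>,
  which therefore vanish.\<close>

lemma integral_wirtinger_eq_0:
  assumes f: "\<And>z. has_wirtinger f (a z) (b z) z"
    and a: "continuous_on UNIV a" and b: "continuous_on UNIV b"
    and supp: "\<And>z. R < cmod z \<Longrightarrow> f z = 0"
  shows "(LINT z|lborel. a z) = 0" "(LINT z|lborel. b z) = 0"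
proof -
  \<comment> \<open>For |\<zeta>| < 1 the function z -> f(\<zeta> - z) is supported in the disc of
    radius R + 1, where this weight is 1.\<close>
  define w :: "complex \<Rightarrow> complex" where "w = indicator (cball 0 (R + 1))"
  have "w = (\<lambda>z. indicat_real (cball 0 (R + 1)) z *\<^sub>R 1)"
    by (auto simp: w_def indicator_def)
  then have "integrable lborel w"
    using borel_integrable_compact[of "cball 0 (R + 1)" "\<lambda>_. 1 :: complex"] by simp
  moreover have "w z = 0" if "R + 1 < cmod z" for z using that by (simp add: w_def)
  ultimately have W: "has_wirtinger (\<lambda>\<zeta>. LINT z|lborel. w z * f (\<zeta> - z))
    (LINT z|lborel. w z * a (0 - z)) (LINT z|lborel. w z * b (0 - z)) 0"
    by (rule has_wirtinger_convolution[OF f a b])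
  have ab0: "a z = 0 \<and> b z = 0" if "R < cmod z" for z
  proof -
    have "open {z :: complex. R < cmod z}" by (intro open_Collect_less continuous_intros)
    then show ?thesis using has_wirtinger_locally_constant[OF f, of "{z. R < cmod z}" z 0] supp that by auto
  qed
  have w: "w z * g (\<zeta> - z) = g (\<zeta> - z)" if "\<zeta> \<in> ball 0 1" "\<And>z. R < cmod z \<Longrightarrow> g z = 0" for g \<zeta> z
  proof (cases "cmod z \<le> R + 1")
    case False
    have "cmod z \<le> cmod \<zeta> + cmod (\<zeta> - z)" by (metis norm_minus_commute norm_triangle_sub)
    then have "R < cmod (\<zeta> - z)" using False that(1) by simp
    then show ?thesis using that(2) by simp
  qed (simp add: w_def)
  have "(LINT z|lborel. w z * f (\<zeta> - z)) = (LINT z|lborel. f z)" if "\<zeta> \<in> ball 0 1" for \<zeta>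
    by (subst w[OF that supp]) (auto simp: lborel_integral_reflect)
  note const = this
  have "(LINT z|lborel. w z * a (0 - z)) = 0" "(LINT z|lborel. w z * b (0 - z)) = 0"
    using has_wirtinger_locally_constant[OF W open_ball _ const] by (metis centre_in_ball zero_less_one)+
  moreover have "(LINT z|lborel. w z * a (0 - z)) = (LINT z|lborel. a z)"
    by (subst w) (use ab0 in \<open>auto simp: lborel_integral_reflect[of a 0, simplified]\<close>)
  moreover have "(LINT z|lborel. w z * b (0 - z)) = (LINT z|lborel. b z)"
    by (subst w) (use ab0 in \<open>auto simp: lborel_integral_reflect[of b 0, simplified]\<close>)
  ultimately show "(LINT z|lborel. a z) = 0" "(LINT z|lborel. b z) = 0" by auto
qed

section \<open>Gradients on zero sets\<close>

lemma integrable_continuous_bounded_support: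
  fixes f :: "complex \<Rightarrow> 'b::{banach, second_countable_topology}"
  assumes "continuous_on UNIV f" "\<And>z. R < cmod z \<Longrightarrow> f z = 0"
  shows "integrable lborel f"
proof -
  have "f = (\<lambda>z. indicator (cball 0 R) z *\<^sub>R f z)"
    using assms(2) by (auto simp: indicator_def fun_eq_iff not_le)
  then show ?thesis
    using borel_integrable_compact[of "cball 0 R" f] continuous_on_subset[OF assms(1)] by simp
qed

lemma if_zero_eq_indicator: "(if z \<in> S then h z else 0) = indicator S z *\<^sub>R (h z :: 'a::real_vector)"
  by (simp add: indicator_def)

lemma borel_measurable_if_continuous_on:
  fixes h :: "complex \<Rightarrow> 'b::{banach, second_countable_topology}"
  assumes "open S" "continuous_on S h"
  shows "(\<lambda>z. if z \<in> S then h z else 0) \<in> borel_measurable borel"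
  unfolding if_zero_eq_indicator
  by (rule borel_measurable_continuous_on_indicator) (use assms in auto)

text \<open>The definitions integrate over \<open>lebesgue_on S\<close>, while convolutions and
  reflections live on the whole plane with \<open>lborel\<close>. Continuity on an open set makes
  the zero extension Borel, so completing the measure changes neither integrability nor the
  integral.\<close>

lemma
  fixes h :: "complex \<Rightarrow> 'b::{banach, second_countable_topology}"
  assumes "open S" "continuous_on S h"
  shows integral_lebesgue_on_open: "(LINT z|lebesgue_on S. h z) = (LINT z|lborel. (if z \<in> S then h z else 0))"
    and integrable_lebesgue_on_open:
      "integrable (lebesgue_on S) h \<longleftrightarrow> integrable lborel (\<lambda>z. if z \<in> S then h z else 0)"
proof -
  have S: "S \<inter> space lebesgue \<in> sets lebesgue" using assms(1) by auto
  note m = borel_measurable_if_continuous_on[OF assms]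
  show "(LINT z|lebesgue_on S. h z) = (LINT z|lborel. (if z \<in> S then h z else 0))"
    using m by (simp add: integral_restrict_space[OF S] if_zero_eq_indicator[symmetric] integral_completion)
  show "integrable (lebesgue_on S) h \<longleftrightarrow> integrable lborel (\<lambda>z. if z \<in> S then h z else 0)"
    using m by (simp add: integrable_restrict_space[OF S] if_zero_eq_indicator[symmetric] integrable_completion)
qed

lemma integrable_bounded_on_bounded_open:
  fixes h :: "complex \<Rightarrow> 'b::{banach, second_countable_topology}"
  assumes "open S" "bounded S" "continuous_on S h" "\<And>z. z \<in> S \<Longrightarrow> norm (h z) \<le> B"
  shows "integrable lborel (\<lambda>z. if z \<in> S then h z else 0)"
proof (rule Bochner_Integration.integrable_bound)
  have "emeasure lborel S < \<infinity>" using emeasure_bounded_finite[OF assms(2)] .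
  then show "integrable lborel (\<lambda>z. B * indicator S z :: real)"
    using assms(1) by (intro integrable_mult_right integrable_real_indicator) auto
  have "norm (if z \<in> S then h z else 0) \<le> norm (B * indicator S z :: real)" for z
    using assms(4)[of z] by (auto simp: indicator_def)
  then show "AE z in lborel. norm (if z \<in> S then h z else 0) \<le> norm (B * indicator S z :: real)" by simp
qed (use borel_measurable_if_continuous_on[OF assms(1,3)] in simp)

text \<open>\<open>N\<close> is a neighbourhood of the complement of \<open>S\<close>. As
  \<open>f\<close> is 0 on the overlap, the extension vanishes on all of \<open>N\<close> and is
  glued from two differentiable pieces on overlapping open sets.\<close>

lemma wirtinger_zero_extension:
  assumes f: "\<And>z. z \<in> S \<Longrightarrow> has_wirtinger f (a z) (b z) z"
    and ab: "continuous_on S a" "continuous_on S b"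
    and S: "open S" and N: "open N" "S \<union> N = UNIV" and fN: "\<And>z. z \<in> S \<Longrightarrow> z \<in> N \<Longrightarrow> f z = 0"
  defines "ext \<equiv> (\<lambda>h z. if z \<in> S then h z else 0 :: complex)"
  shows "has_wirtinger (ext f) (ext a z) (ext b z) z"
    and "continuous_on UNIV (ext a)" "continuous_on UNIV (ext b)"
proof -
  have z0: "a z = 0 \<and> b z = 0" if "z \<in> S" "z \<in> N" for z
    using has_wirtinger_locally_constant[OF f[OF that(1)], of "S \<inter> N" 0] fN that S N by auto
  show "has_wirtinger (ext f) (ext a z) (ext b z) z"
  proof (cases "z \<in> S")
    case True
    show ?thesis
      by (rule has_wirtinger_cong_open[OF _ S True, of f]) (use f True in \<open>auto simp: ext_def\<close>)
  next
    case False
    then have "z \<in> N" using N by blast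
    show ?thesis
      by (rule has_wirtinger_cong_open[OF _ N(1) \<open>z \<in> N\<close>, of "\<lambda>_. 0"])
        (use False fN has_wirtinger_const[of 0] in \<open>auto simp: ext_def\<close>)
  qed
  have "continuous_on UNIV (ext h)" if "continuous_on S h" "\<And>z. z \<in> S \<Longrightarrow> z \<in> N \<Longrightarrow> h z = 0" for h
  proof -
    have "continuous_on S (ext h)"
      using that(1) by (rule continuous_on_eq) (simp add: ext_def)
    moreover have "continuous_on N (ext h)"
      by (rule continuous_on_eq[of _ "\<lambda>_. 0"]) (use that in \<open>auto simp: ext_def\<close>)
    ultimately show ?thesis using continuous_on_open_Un[OF S N(1)] N(2) by metis
  qed
  then show "continuous_on UNIV (ext a)" "continuous_on UNIV (ext b)"
    using ab z0 by blast+
qed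

text \<open>The squared positive part is the building block of the cutoffs below: it is C^1, which
  suffices for \<open>integral_wirtinger_eq_0\<close>.\<close>

lemma DERIV_pos_part_sq: "((\<lambda>t. (max 0 t)\<^sup>2) has_real_derivative 2 * max 0 t) (at t)"
proof -
  consider "t < 0" | "t > 0" | "t = 0" by linarith
  then show ?thesis
  proof cases
    case 1
    show ?thesis
      by (rule has_field_derivative_transform_within_open[of "\<lambda>_. 0" _ _ "{..<0}"])
        (use 1 in auto)
  next
    case 2
    show ?thesis
      by (rule has_field_derivative_transform_within_open[of "\<lambda>t. t\<^sup>2" _ _ "{0<..}"])
        (use 2 in \<open>auto intro!: derivative_eq_intros\<close>)
  next
    case 3
    have "((\<lambda>h. (max 0 h)\<^sup>2 / h) \<longlongrightarrow> 0) (at (0::real))"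
    proof (rule Lim_null_comparison)
      show "\<forall>\<^sub>F h in at 0. norm ((max 0 h)\<^sup>2 / h) \<le> \<bar>h\<bar>"
        by (rule always_eventually) (auto simp: max_def power2_eq_square)
      show "((\<lambda>h. \<bar>h\<bar>) \<longlongrightarrow> 0) (at (0::real))" by (rule tendsto_eq_intros | simp)+
    qed
    then show ?thesis using 3 by (simp add: DERIV_def)
  qed
qed

lemma continuous_on_of_wirtinger:
  "(\<And>z. has_wirtinger f (a z) (b z) z) \<Longrightarrow> continuous_on S f"
  by (meson continuous_at_imp_continuous_on has_wirtinger_isCont)

text \<open>With \<open>f = \<epsilon> arctan (\<phi> / \<epsilon>)\<close>, integrating the derivative of \<open>f\<close> against a compactly supported
  multiple of the conjugate gradient bounds the gradient on \<open>{\<phi> = 0}\<close> by a multiple of \<open>\<epsilon>\<close>.\<close>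

lemma AE_gradient_zero_on_zero_set:
  assumes \<phi>: "\<And>z. has_wirtinger \<phi> (\<alpha> z) (cnj (\<alpha> z)) z" and real: "\<And>z. of_real (Re (\<phi> z)) = \<phi> z"
    and \<alpha>: "\<And>z. has_wirtinger \<alpha> (r z) (s z) z" and rs: "continuous_on UNIV r" "continuous_on UNIV s"
  shows "AE z in lborel. \<phi> z = 0 \<longrightarrow> \<alpha> z = 0"
proof -
  have c\<phi>[continuous_intros]: "continuous_on UNIV \<phi>" by (rule continuous_on_of_wirtinger[OF \<phi>])
  have c\<alpha>[continuous_intros]: "continuous_on UNIV \<alpha>" by (rule continuous_on_of_wirtinger[OF \<alpha>])
  note rs[continuous_intros]
  have "AE z in lborel. cmod z < real n \<longrightarrow> \<phi> z = 0 \<longrightarrow> \<alpha> z = 0" for n :: nat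
  proof -
    define R where "R = real n"
    \<comment> \<open>A C^1 bump, positive exactly on the disc of radius R; \<open>c'\<close> is its
      derivative with respect to the squared modulus.\<close>
    define c where "c z = (max 0 (R\<^sup>2 - (cmod z)\<^sup>2))\<^sup>2" for z
    define c' where "c' z = - 2 * max 0 (R\<^sup>2 - (cmod z)\<^sup>2)" for z
    have c0: "c z = 0" "c' z = 0" if "R < cmod z" for z
      using that by (auto simp: c_def c'_def R_def power_mono)
    have c_pos: "c z > 0" if "cmod z < R" for z
      using power_strict_mono[OF that, of 2] by (simp add: c_def)
    have c_nonneg: "c z \<ge> 0" for z by (simp add: c_def)
    have cc[continuous_intros]: "continuous_on UNIV c" "continuous_on UNIV c'"
      unfolding c_def[abs_def] c'_def[abs_def] by (intro continuous_intros)+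
    have "((\<lambda>t. (max 0 (R\<^sup>2 - t))\<^sup>2) has_real_derivative 2 * max 0 (R\<^sup>2 - t) * (-1)) (at t)" for t
      by (rule DERIV_chain2[OF DERIV_pos_part_sq]) (auto intro!: derivative_eq_intros)
    from has_wirtinger_norm_sq_compose[OF this]
    have wc: "has_wirtinger (\<lambda>z. of_real (c z)) (of_real (c' z) * cnj z) (of_real (c' z) * z) z" for z
      unfolding c_def c'_def by simp
    \<comment> \<open>Chosen so that \<alpha> B = |\<alpha>|^2 c, the nonnegative quantity to be
      estimated.\<close>
    define B where "B z = cnj (\<alpha> z) * of_real (c z)" for z
    define B1 where "B1 z = cnj (s z) * of_real (c z) + cnj (\<alpha> z) * (of_real (c' z) * cnj z)" for z
    define B2 where "B2 z = cnj (r z) * of_real (c z) + cnj (\<alpha> z) * (of_real (c' z) * z)" for z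
    have wB: "has_wirtinger B (B1 z) (B2 z) z" for z
      unfolding B_def[abs_def] B1_def B2_def by (intro has_wirtinger_mult has_wirtinger_cnj \<alpha> wc)
    have cB[continuous_intros]: "continuous_on UNIV B" "continuous_on UNIV B1" "continuous_on UNIV B2"
      unfolding B_def[abs_def] B1_def[abs_def] B2_def[abs_def] by (intro continuous_intros)+
    have B0: "B z = 0" "B1 z = 0" if "R < cmod z" for z
      using c0[OF that] by (auto simp: B_def B1_def)
    define M where "M = (LINT z|lborel. cmod (B1 z))"
    have iB1: "integrable lborel (\<lambda>z. cmod (B1 z))"
      by (rule integrable_continuous_bounded_support[of _ R]) (auto intro!: continuous_intros simp: B0)
    define h where "h z = indicator {z. \<phi> z = 0} z * ((cmod (\<alpha> z))\<^sup>2 * c z)" for z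
    have cont_h: "continuous_on UNIV (\<lambda>z. (cmod (\<alpha> z))\<^sup>2 * c z)" by (intro continuous_intros)
    have ih: "integrable lborel h"
    proof (rule Bochner_Integration.integrable_bound)
      show "integrable lborel (\<lambda>z. (cmod (\<alpha> z))\<^sup>2 * c z)"
        by (rule integrable_continuous_bounded_support[of _ R, OF cont_h]) (auto simp: c0)
      have "closed {z. \<phi> z = 0}" by (intro closed_Collect_eq continuous_intros)
      then have "indicat_real {z. \<phi> z = 0} \<in> borel_measurable borel"
        by (intro borel_measurable_indicator) simp
      from borel_measurable_times[OF this borel_measurable_continuous_onI[OF cont_h]]
      show "h \<in> borel_measurable lborel"
        unfolding h_def[abs_def] by simp
    qed (auto simp: h_def indicator_def)
    have h_nonneg: "h z \<ge> 0" for z by (simp add: h_def c_nonneg)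
    have bound: "(LINT z|lborel. h z) \<le> \<epsilon> * (2 * M)" if \<epsilon>: "\<epsilon> > 0" for \<epsilon> :: real
    proof -
      \<comment> \<open>\<open>D\<close> is the slope of the scaled arctan \<open>E\<close>. It is 1
        on the zero set of \<phi>, whereas |E| \<le> 2 \<epsilon> everywhere because pi / 2 <
        2.\<close>
      define D where "D z = 1 / (1 + (Re (\<phi> z) / \<epsilon>)\<^sup>2)" for z
      define E where "E z = \<epsilon> * arctan (Re (\<phi> z) / \<epsilon>)" for z
      have "1 + (x::real)\<^sup>2 \<noteq> 0" for x by (metis add_pos_nonneg less_irrefl zero_le_power2 zero_less_one)
      then have cDE[continuous_intros]: "continuous_on UNIV D" "continuous_on UNIV E"
        unfolding D_def[abs_def] E_def[abs_def] using \<epsilon> by (intro continuous_intros; simp)+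
      have wE: "has_wirtinger (\<lambda>z. of_real (E z)) (of_real (D z) * \<alpha> z) (of_real (D z) * cnj (\<alpha> z)) z" for z
        unfolding E_def D_def
        by (rule has_wirtinger_real_compose[OF \<phi>, of "\<lambda>t. \<epsilon> * arctan (t / \<epsilon>)"])
          (use \<epsilon> in \<open>auto intro!: derivative_eq_intros simp: inverse_eq_divide\<close>)
      have "(LINT z|lborel. (of_real (D z) * \<alpha> z) * B z + of_real (E z) * B1 z) = 0"
      proof (rule integral_wirtinger_eq_0(1)[where R = R])
        show "has_wirtinger (\<lambda>z. of_real (E z) * B z) ((of_real (D z) * \<alpha> z) * B z + of_real (E z) * B1 z)
           ((of_real (D z) * cnj (\<alpha> z)) * B z + of_real (E z) * B2 z) z" for z
          by (intro has_wirtinger_mult wE wB)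
      qed (auto intro!: continuous_intros simp: B0)
      moreover have i1: "integrable lborel (\<lambda>z. (of_real (D z) * \<alpha> z) * B z)"
        and i2: "integrable lborel (\<lambda>z. of_real (E z) * B1 z)"
        by (rule integrable_continuous_bounded_support[of _ R]; (auto intro!: continuous_intros simp: B0)[1])+
      ultimately have eq: "(LINT z|lborel. (of_real (D z) * \<alpha> z) * B z) = - (LINT z|lborel. of_real (E z) * B1 z)"
        by (simp add: eq_neg_iff_add_eq_0)
      have DB: "(of_real (D z) * \<alpha> z) * B z = of_real (D z * ((cmod (\<alpha> z))\<^sup>2 * c z))" for z
        unfolding B_def of_real_mult complex_norm_square by (simp only: mult_ac)
      have iD: "integrable lborel (\<lambda>z. D z * ((cmod (\<alpha> z))\<^sup>2 * c z))"
        by (rule integrable_continuous_bounded_support[of _ R]) (auto intro!: continuous_intros simp: c0)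
      have D0: "D z \<ge> 0" for z by (simp add: D_def)
      have "(LINT z|lborel. h z) \<le> (LINT z|lborel. D z * ((cmod (\<alpha> z))\<^sup>2 * c z))"
        by (rule integral_mono[OF ih iD]) (auto simp: h_def indicator_def D_def c_nonneg)
      also have "\<dots> \<le> cmod (of_real (LINT z|lborel. D z * ((cmod (\<alpha> z))\<^sup>2 * c z)))" by simp
      also have "\<dots> = cmod (LINT z|lborel. (of_real (D z) * \<alpha> z) * B z)"
        unfolding DB by (simp only: integral_complex_of_real)
      also have "\<dots> = cmod (LINT z|lborel. of_real (E z) * B1 z)" by (simp only: eq norm_minus_cancel)
      also have "\<dots> \<le> (LINT z|lborel. cmod (of_real (E z) * B1 z))" by (rule integral_norm_bound)
      also have "\<dots> \<le> (LINT z|lborel. (\<epsilon> * 2) * cmod (B1 z))"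
      proof (rule integral_mono)
        show "integrable lborel (\<lambda>z. cmod (of_real (E z) * B1 z))" using i2 by (rule integrable_norm)
        fix z
        have "\<bar>arctan (Re (\<phi> z) / \<epsilon>)\<bar> \<le> 2"
          using arctan_bounded[of "Re (\<phi> z) / \<epsilon>"] pi_half_less_two by linarith
        then have "\<bar>E z\<bar> \<le> \<epsilon> * 2" using \<epsilon> by (auto simp: E_def abs_mult)
        then show "cmod (of_real (E z) * B1 z) \<le> (\<epsilon> * 2) * cmod (B1 z)"
          by (simp add: norm_mult mult_right_mono)
      qed (use iB1 in simp)
      also have "\<dots> = \<epsilon> * (2 * M)" by (simp add: M_def)
      finally show ?thesis .
    qed
    have "(LINT z|lborel. h z) \<le> 0"
    proof (rule ccontr)
      assume "\<not> ?thesis"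
      then have J: "(LINT z|lborel. h z) > 0" by simp
      have "M \<ge> 0" by (simp add: M_def)
      \<comment> \<open>With J the integral of \<open>h\<close>, this choice of \<epsilon> gives J
        \<le> J M / (2 (M + 1)) < J.\<close>
      with bound[of "(LINT z|lborel. h z) / (4 * (M + 1))"] J show False
        by (simp add: field_simps) (smt (verit) mult_nonneg_nonneg)
    qed
    moreover have "(LINT z|lborel. h z) \<ge> 0" using h_nonneg by (intro Bochner_Integration.integral_nonneg) auto
    ultimately have "(LINT z|lborel. h z) = 0" by (rule antisym)
    then have "AE z in lborel. h z = 0"
      using integral_nonneg_eq_0_iff_AE[OF ih] h_nonneg by simp
    then show ?thesis
    proof eventually_elim
      case (elim z)
      then show ?case using c_pos[of z] by (auto simp: h_def indicator_def R_def split: if_splits)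
    qed
  qed
  then have "AE z in lborel. \<forall>n::nat. cmod z < real n \<longrightarrow> \<phi> z = 0 \<longrightarrow> \<alpha> z = 0"
    unfolding AE_all_countable by blast
  then show ?thesis by eventually_elim (use reals_Archimedean2 in blast)
qed

section \<open>Integration by parts against antiholomorphic functions\<close>

text \<open>\<open>cutoff n\<close> is continuously differentiable and vanishes on \<open>n t\<^sup>2 \<le> 1\<close>, so that for \<open>\<phi> = 0\<close> on the
  boundary \<open>cutoff n \<circ> \<phi>\<close> has compact support in the domain, without any regularity of the boundary.\<close>

definition cutoff :: "real \<Rightarrow> real \<Rightarrow> real" where
  "cutoff n t = t * ((max 0 (n * t\<^sup>2 - 1))\<^sup>2 / (1 + (max 0 (n * t\<^sup>2 - 1))\<^sup>2))"

text \<open>The derivative of \<open>cutoff n\<close> at t, in the variable s = max 0 (n t^2 - 1).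
  The chain rule produces s n t^2, which equals s (s + 1) even where s = 0. As n and t enter only
  through s, bounds on the slope are uniform in n.\<close>

definition cutoff_slope :: "real \<Rightarrow> real" where
  "cutoff_slope s = s\<^sup>2 / (1 + s\<^sup>2) + 4 * s * (s + 1) / (1 + s\<^sup>2)\<^sup>2"

lemma one_plus_sq_pos: "1 + (x::real)\<^sup>2 > 0"
  by (metis add_pos_nonneg zero_le_power2 zero_less_one)

lemma DERIV_cutoff:
  "(cutoff n has_real_derivative cutoff_slope (max 0 (n * t\<^sup>2 - 1))) (at t)"
proof -
  define P where "P t = (max 0 (n * t\<^sup>2 - 1))\<^sup>2" for t
  define s where "s = max 0 (n * t\<^sup>2 - 1)"
  have "(P has_real_derivative 2 * s * (n * (2 * t))) (at t)"
    unfolding P_def[abs_def] s_def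
    by (rule DERIV_chain2[OF DERIV_pos_part_sq]) (auto intro!: derivative_eq_intros)
  moreover have Pt: "P t = s\<^sup>2" by (simp add: P_def s_def)
  moreover have nz: "1 + P t \<noteq> 0" using one_plus_sq_pos[of s] Pt by simp
  ultimately have "((\<lambda>t. P t / (1 + P t)) has_real_derivative
      (2 * s * (n * (2 * t)) * (1 + P t) - P t * (0 + 2 * s * (n * (2 * t)))) / ((1 + P t) * (1 + P t))) (at t)"
    by (intro DERIV_divide DERIV_add DERIV_const)
  from DERIV_mult[OF DERIV_ident this] have "((\<lambda>t. t * (P t / (1 + P t))) has_real_derivative
      s\<^sup>2 / (1 + s\<^sup>2) + t * ((2 * s * (n * (2 * t)) * (1 + s\<^sup>2) - s\<^sup>2 * (2 * s * (n * (2 * t)))) / (1 + s\<^sup>2)\<^sup>2)) (at t)"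
    unfolding Pt by (simp add: mult.commute power2_eq_square[of "1 + s\<^sup>2"])
  moreover have "t * (2 * s * (n * (2 * t)) * (1 + s\<^sup>2) - s\<^sup>2 * (2 * s * (n * (2 * t)))) = 4 * s * (n * t\<^sup>2)"
    by (simp add: power2_eq_square algebra_simps)
  moreover have "s * (n * t\<^sup>2) = s * (s + 1)" by (auto simp: s_def max_def)
  ultimately show ?thesis
    by (simp add: cutoff_def[abs_def] P_def[symmetric] cutoff_slope_def s_def[symmetric] mult.assoc)
qed

lemma cutoff_eq_0: "n * t\<^sup>2 \<le> 1 \<Longrightarrow> cutoff n t = 0"
  by (simp add: cutoff_def)

lemma continuous_on_cutoff_slope: "continuous_on UNIV cutoff_slope"
proof -
  have "(1 + s\<^sup>2) \<noteq> 0" for s :: real using one_plus_sq_pos[of s] by simp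
  then show ?thesis unfolding cutoff_slope_def[abs_def] by (intro continuous_intros) auto
qed

text \<open>9 = 1 + 8: the first summand is at most 1, and s (s + 1) \<le> 2 (1 + s^2) bounds the
  second by 8.\<close>

lemma abs_cutoff_slope_le:
  assumes "s \<ge> 0"
  shows "\<bar>cutoff_slope s\<bar> \<le> 9"
proof -
  have p: "1 + s\<^sup>2 \<ge> 1" by simp
  have "2 * s \<le> 1 + s\<^sup>2" using zero_le_power2[of "s - 1"] by (simp add: power2_diff)
  then have "s * (s + 1) \<le> 2 * (1 + s\<^sup>2)" using assms by (simp add: power2_eq_square algebra_simps)
  also have "\<dots> \<le> 2 * (1 + s\<^sup>2)\<^sup>2" using self_le_power[OF p, of 2] by simp
  finally have "4 * s * (s + 1) \<le> 8 * (1 + s\<^sup>2)\<^sup>2" by linarith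
  moreover have "(1 + s\<^sup>2)\<^sup>2 > 0" using p by (intro zero_less_power) linarith
  ultimately have "4 * s * (s + 1) / (1 + s\<^sup>2)\<^sup>2 \<le> 8" by (simp only: pos_divide_le_eq)
  moreover have "s\<^sup>2 / (1 + s\<^sup>2) \<le> 1"
    using one_plus_sq_pos[of s] by (simp add: divide_le_eq_1_pos)
  moreover have "s\<^sup>2 / (1 + s\<^sup>2) \<ge> 0" "4 * s * (s + 1) / (1 + s\<^sup>2)\<^sup>2 \<ge> 0" using assms by simp_all
  ultimately show ?thesis unfolding cutoff_slope_def by linarith
qed

text \<open>At t = 0 the slope is 0 for every n instead of tending to 1;
  \<open>AE_gradient_zero_on_zero_set\<close> takes care of those points.\<close>

lemma cutoff_slope_tendsto:
  assumes "t \<noteq> 0"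
  shows "(\<lambda>n. cutoff_slope (max 0 (real n * t\<^sup>2 - 1))) \<longlonglongrightarrow> 1"
proof -
  have "t\<^sup>2 > 0" using assms by simp
  then have "filterlim (\<lambda>n. real n * t\<^sup>2 - 1) at_top sequentially" by real_asymp
  then have lim: "filterlim (\<lambda>n. max 0 (real n * t\<^sup>2 - 1)) at_top sequentially"
    by (rule filterlim_at_top_mono) auto
  have "(cutoff_slope \<longlongrightarrow> 1) at_top" unfolding cutoff_slope_def[abs_def] by real_asymp
  from filterlim_compose[OF this lim] show ?thesis .
qed

lemma bounded_continuous_on_bounded:
  fixes f :: "complex \<Rightarrow> complex"
  assumes "continuous_on UNIV f" "bounded S"
  obtains M where "\<And>z. z \<in> S \<Longrightarrow> cmod (f z) \<le> M"
proof -
  have "compact (f ` closure S)"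
    using assms by (intro compact_continuous_image continuous_on_subset[OF assms(1)]) (auto simp: compact_closure)
  then have "bounded (f ` S)"
    by (meson bounded_subset closure_subset compact_imp_bounded image_mono)
  then show thesis using that by (auto simp: bounded_iff)
qed

text \<open>The z-derivative of cnj g is 0. Differentiating the cutoff of \<phi> times cnj g, a
  function with compact support in \<open>S\<close>, thus only produces the slope times \<alpha> cnj
  g, whose integral is 0. Dominated convergence with the bound 9 M |g| removes the slope.\<close>

lemma integral_gradient_times_antiholomorphic_real:
  assumes \<phi>: "\<And>z. has_wirtinger \<phi> (\<alpha> z) (cnj (\<alpha> z)) z" and real: "\<And>z. of_real (Re (\<phi> z)) = \<phi> z"
    and \<alpha>: "\<And>z. has_wirtinger \<alpha> (r z) (s z) z" and rs: "continuous_on UNIV r" "continuous_on UNIV s"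
    and S: "open S" "bounded S" and \<phi>0: "\<And>z. z \<in> frontier S \<Longrightarrow> \<phi> z = 0"
    and g: "g holomorphic_on S" and ig: "integrable lborel (\<lambda>z. if z \<in> S then cmod (g z) else 0)"
  shows "(LINT z|lborel. (if z \<in> S then \<alpha> z * cnj (g z) else 0)) = 0"
proof -
  have c\<phi>: "continuous_on A \<phi>" and c\<alpha>: "continuous_on A \<alpha>" for A
    by (rule continuous_on_of_wirtinger[OF \<phi>], rule continuous_on_of_wirtinger[OF \<alpha>])
  have cg: "continuous_on S g" using g holomorphic_on_imp_continuous_on by blast
  have cg': "continuous_on S (deriv g)"
    using g S holomorphic_deriv holomorphic_on_imp_continuous_on by blast
  obtain R where R: "\<And>z. z \<in> S \<Longrightarrow> cmod z \<le> R" using S(2) bounded_iff by blast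
  have R0: "z \<notin> S" if "R < cmod z" for z using R[of z] that by auto
  define G where "G n z = cutoff_slope (max 0 (real n * (Re (\<phi> z))\<^sup>2 - 1))" for n :: nat and z
  have cG: "continuous_on S (G n)" for n
    unfolding G_def[abs_def]
    by (intro continuous_on_compose2[OF continuous_on_cutoff_slope] continuous_intros c\<phi>) auto
  have "(LINT z|lborel. (if z \<in> S then of_real (G n z) * \<alpha> z * cnj (g z) else 0)) = 0" for n :: nat
  proof -
    \<comment> \<open>An open set containing the complement of \<open>S\<close>: frontier points lie
      in the first part because \<phi> = 0 there.\<close>
    define N where "N = {z. real n * (Re (\<phi> z))\<^sup>2 < 1} \<union> - closure S"
    have "open {z. real n * (Re (\<phi> z))\<^sup>2 < 1}" by (intro open_Collect_less continuous_intros c\<phi>)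
    then have N: "open N" by (auto simp: N_def)
    have "z \<in> N" if "z \<notin> S" for z
      using \<phi>0[of z] that S(1) by (auto simp: N_def frontier_def interior_open)
    then have SN: "S \<union> N = UNIV" by blast
    let ?f = "\<lambda>z. of_real (cutoff (real n) (Re (\<phi> z))) * cnj (g z)"
    let ?a = "\<lambda>z. of_real (G n z) * \<alpha> z * cnj (g z)"
    let ?b = "\<lambda>z. of_real (G n z) * cnj (\<alpha> z) * cnj (g z) + of_real (cutoff (real n) (Re (\<phi> z))) * cnj (deriv g z)"
    have w: "has_wirtinger ?f (?a z) (?b z) z" if "z \<in> S" for z
    proof -
      have "has_wirtinger g (deriv g z) 0 z"
        using has_wirtinger_of_field_derivative holomorphic_derivI[OF g S(1) that] by blast
      from has_wirtinger_mult[OF has_wirtinger_real_compose[OF \<phi> DERIV_cutoff] has_wirtinger_cnj[OF this]]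
      show ?thesis by (simp add: G_def)
    qed
    have cc: "continuous_on S (\<lambda>z. cutoff (real n) (Re (\<phi> z)))"
    proof (rule continuous_on_compose2[of UNIV "cutoff (real n)"])
      show "continuous_on UNIV (cutoff (real n))"
        using DERIV_cutoff DERIV_isCont continuous_at_imp_continuous_on by blast
    qed (auto intro: continuous_intros c\<phi>)
    have ca: "continuous_on S ?a" and cb: "continuous_on S ?b"
      by (intro continuous_intros cG c\<alpha> cg cg' cc)+
    have f0: "?f z = 0" if "z \<in> S" "z \<in> N" for z
    proof -
      have "real n * (Re (\<phi> z))\<^sup>2 < 1" using that closure_subset[of S] by (auto simp: N_def)
      then show ?thesis using cutoff_eq_0[of "real n" "Re (\<phi> z)"] by simp
    qed
    note ext = wirtinger_zero_extension[OF w ca cb S(1) N SN f0]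
    show ?thesis
    proof (rule integral_wirtinger_eq_0(1)[OF ext(1) ext(2) ext(3)])
      fix z assume "R < cmod z"
      then have "z \<notin> S" by (rule R0)
      then show "(if z \<in> S then ?f z else 0) = 0" by simp
    qed
  qed
  moreover have "(\<lambda>n. LINT z|lborel. (if z \<in> S then of_real (G n z) * \<alpha> z * cnj (g z) else 0))
      \<longlonglongrightarrow> (LINT z|lborel. (if z \<in> S then \<alpha> z * cnj (g z) else 0))"
  proof -
    obtain M where M: "\<And>z. z \<in> S \<Longrightarrow> cmod (\<alpha> z) \<le> M"
      using bounded_continuous_on_bounded[OF c\<alpha> S(2)] by blast
    show ?thesis
    proof (rule integral_dominated_convergence)
      show "(\<lambda>z. if z \<in> S then \<alpha> z * cnj (g z) else 0) \<in> borel_measurable lborel"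
        using borel_measurable_if_continuous_on[OF S(1), of "\<lambda>z. \<alpha> z * cnj (g z)"]
        by (simp add: continuous_intros c\<alpha> cg)
      show "(\<lambda>z. if z \<in> S then of_real (G n z) * \<alpha> z * cnj (g z) else 0) \<in> borel_measurable lborel" for n
        using borel_measurable_if_continuous_on[OF S(1), of "\<lambda>z. of_real (G n z) * \<alpha> z * cnj (g z)"]
        by (simp add: continuous_intros c\<alpha> cg cG)
      show "integrable lborel (\<lambda>z. 9 * M * (if z \<in> S then cmod (g z) else 0))" using ig by simp
      show "AE z in lborel. cmod (if z \<in> S then of_real (G n z) * \<alpha> z * cnj (g z) else 0)
          \<le> 9 * M * (if z \<in> S then cmod (g z) else 0)" for n
      proof (rule AE_I2)
        fix z
        have "\<bar>G n z\<bar> \<le> 9" unfolding G_def by (rule abs_cutoff_slope_le) simp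
        then have "\<bar>G n z\<bar> * cmod (\<alpha> z) \<le> 9 * M" if "z \<in> S" using M[OF that] by (intro mult_mono) auto
        then show "cmod (if z \<in> S then of_real (G n z) * \<alpha> z * cnj (g z) else 0)
          \<le> 9 * M * (if z \<in> S then cmod (g z) else 0)"
          by (auto simp: norm_mult intro!: mult_right_mono)
      qed
      show "AE z in lborel. (\<lambda>n. if z \<in> S then of_real (G n z) * \<alpha> z * cnj (g z) else 0)
          \<longlonglongrightarrow> (if z \<in> S then \<alpha> z * cnj (g z) else 0)"
        \<comment> \<open>Where \<phi> = 0 both sides are 0 because \<alpha> is; elsewhere the slope
          tends to 1.\<close>
        using AE_gradient_zero_on_zero_set[OF \<phi> real \<alpha> rs]
      proof eventually_elim
        case (elim z)
        show ?case
        proof (cases "\<phi> z = 0")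
          case False
          then have "Re (\<phi> z) \<noteq> 0" using real[of z] by auto
          then have "(\<lambda>n. G n z) \<longlonglongrightarrow> 1" unfolding G_def by (rule cutoff_slope_tendsto)
          then have "(\<lambda>n. of_real (G n z) * \<alpha> z * cnj (g z)) \<longlonglongrightarrow> of_real 1 * \<alpha> z * cnj (g z)"
            by (intro tendsto_intros)
          then show ?thesis by simp
        qed (use elim in simp)
      qed
    qed
  qed
  ultimately show ?thesis by (simp add: LIMSEQ_const_iff)
qed

text \<open>The real case is applied to c \<phi> + cnj (c \<phi>) for c = 1 and c = i. Up to a
  factor i, the results are the sum and the difference of the wanted integral and the one with cnj
  \<beta>, so both integrals vanish.\<close>

lemma integral_gradient_times_antiholomorphic:
  assumes \<phi>: "polynomial_function \<phi>" and w: "\<And>z. has_wirtinger \<phi> (\<alpha> z) (\<beta> z) z"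
    and S: "open S" "bounded S" and \<phi>0: "\<And>z. z \<in> frontier S \<Longrightarrow> \<phi> z = 0"
    and g: "g holomorphic_on S" and ig: "integrable lborel (\<lambda>z. if z \<in> S then cmod (g z) else 0)"
  shows "(LINT z|lborel. (if z \<in> S then \<alpha> z * cnj (g z) else 0)) = 0"
proof -
  obtain p q r s t where *: "polynomial_function p" "polynomial_function q"
    "polynomial_function r" "polynomial_function s" "polynomial_function t"
    "\<And>z. has_wirtinger \<phi> (p z) (q z) z" "\<And>z. has_wirtinger p (r z) (s z) z"
    "\<And>z. has_wirtinger q (s z) (t z) z"
    using polynomial_function_wirtinger2[OF \<phi>] by metis
  have cont: "continuous_on UNIV r" "continuous_on UNIV s" "continuous_on UNIV t"
    using * continuous_on_polymonial_function by blast+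
  \<comment> \<open>The real case needs derivatives of the gradient, which are at hand for
    \<open>p\<close>; uniqueness of the derivative identifies \<open>p\<close> with the given
    \<alpha>.\<close>
  have p: "p z = \<alpha> z" for z
  proof -
    have "(\<lambda>h. p z * h + q z * cnj h) = (\<lambda>h. \<alpha> z * h + \<beta> z * cnj h)"
      using w[of z] *(6)[of z] unfolding has_wirtinger_def by (rule has_derivative_unique[rotated])
    from fun_cong[OF this, of 1] fun_cong[OF this, of \<i>] show ?thesis
      by (auto simp: complex_eq_iff)
  qed
  have main: "(LINT z|lborel. (if z \<in> S then (c * p z + cnj c * cnj (q z)) * cnj (g z) else 0)) = 0" for c
  proof (rule integral_gradient_times_antiholomorphic_real[where \<phi> = "\<lambda>z. c * \<phi> z + cnj c * cnj (\<phi> z)"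
        and r = "\<lambda>z. c * r z + cnj c * cnj (t z)" and s = "\<lambda>z. c * s z + cnj c * cnj (s z)"])
    let ?\<phi> = "\<lambda>z. c * \<phi> z + cnj c * cnj (\<phi> z)"
    have "has_wirtinger ?\<phi> ((0 * \<phi> z + c * p z) + (0 * cnj (\<phi> z) + cnj c * cnj (q z)))
      ((0 * \<phi> z + c * q z) + (0 * cnj (\<phi> z) + cnj c * cnj (p z))) z" for z
      by (intro has_wirtinger_add has_wirtinger_mult has_wirtinger_const has_wirtinger_cnj *)
    then show "has_wirtinger ?\<phi> (c * p z + cnj c * cnj (q z)) (cnj (c * p z + cnj c * cnj (q z))) z" for z
      by (simp add: add.commute)
    have "has_wirtinger (\<lambda>z. c * p z + cnj c * cnj (q z)) ((0 * p z + c * r z) + (0 * cnj (q z) + cnj c * cnj (t z)))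
      ((0 * p z + c * s z) + (0 * cnj (q z) + cnj c * cnj (s z))) z" for z
      by (intro has_wirtinger_add has_wirtinger_mult has_wirtinger_const has_wirtinger_cnj *)
    then show "has_wirtinger (\<lambda>z. c * p z + cnj c * cnj (q z)) (c * r z + cnj c * cnj (t z))
      (c * s z + cnj c * cnj (s z)) z" for z
      by simp
    show "continuous_on UNIV (\<lambda>z. c * r z + cnj c * cnj (t z))"
      "continuous_on UNIV (\<lambda>z. c * s z + cnj c * cnj (s z))"
      by (intro continuous_intros cont)+
    show "of_real (Re (?\<phi> z)) = ?\<phi> z" for z by (simp add: complex_eq_iff)
  qed (use \<phi>0 S g ig in auto)
  have i: "integrable lborel (\<lambda>z. if z \<in> S then u z * cnj (g z) else 0)" if u: "polynomial_function u" for u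
  proof -
    have cu: "continuous_on A u" for A using u continuous_on_polymonial_function by blast
    obtain M where M: "\<And>z. z \<in> S \<Longrightarrow> cmod (u z) \<le> M"
      using bounded_continuous_on_bounded[OF cu S(2)] by blast
    show ?thesis
    proof (rule Bochner_Integration.integrable_bound)
      show "integrable lborel (\<lambda>z. M * (if z \<in> S then cmod (g z) else 0))" using ig by simp
      have "cmod (if z \<in> S then u z * cnj (g z) else 0) \<le> norm (M * (if z \<in> S then cmod (g z) else 0))" for z
        using order_trans[OF M[of z] abs_ge_self] by (auto simp: norm_mult abs_mult intro!: mult_right_mono)
      then show "AE z in lborel. cmod (if z \<in> S then u z * cnj (g z) else 0)
          \<le> norm (M * (if z \<in> S then cmod (g z) else 0))" by simp
      show "(\<lambda>z. if z \<in> S then u z * cnj (g z) else 0) \<in> borel_measurable lborel"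
        using borel_measurable_if_continuous_on[OF S(1), of "\<lambda>z. u z * cnj (g z)"]
          holomorphic_on_imp_continuous_on[OF g] by (simp add: continuous_intros cu)
    qed
  qed
  let ?I = "\<lambda>u. (LINT z|lborel. (if z \<in> S then u z * cnj (g z) else 0))"
  have split: "?I (\<lambda>z. c * p z + d * cnj (q z)) = c * ?I p + d * ?I (\<lambda>z. cnj (q z))" for c d
  proof -
    have "(if z \<in> S then (c * p z + d * cnj (q z)) * cnj (g z) else 0) =
      c * (if z \<in> S then p z * cnj (g z) else 0) + d * (if z \<in> S then cnj (q z) * cnj (g z) else 0)" for z
      by (simp add: algebra_simps)
    then show ?thesis using i[OF *(1)] i[OF polynomial_function_cnj[OF *(2)]] by simp
  qed
  have "?I p + ?I (\<lambda>z. cnj (q z)) = 0" "\<i> * ?I p - \<i> * ?I (\<lambda>z. cnj (q z)) = 0"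
    using main[of 1, unfolded complex_cnj_one split] main[of \<i>, unfolded complex_cnj_i split] by simp_all
  then have "?I p = 0" by (simp add: complex_eq_iff)
  then show ?thesis by (simp only: p)
qed

section \<open>From the Dirichlet problem to the Bergman projection\<close>

lemma frechet_derivative_wirtinger:
  "has_wirtinger f a b z \<Longrightarrow> frechet_derivative f (at z) v = a * v + b * cnj v"
  unfolding has_wirtinger_def using frechet_derivative_at by metis

lemma has_wirtinger_differentiable: "has_wirtinger f a b z \<Longrightarrow> f differentiable (at z)"
  unfolding has_wirtinger_def differentiable_def by blast

text \<open>The x-derivative is p + q and the y-derivative is i (p - q); in the sum of the second
  derivatives \<open>r\<close> and \<open>t\<close> cancel.\<close>

lemma laplacian_wirtinger:
  assumes U: "open U" "z \<in> U" and f: "\<And>w. w \<in> U \<Longrightarrow> has_wirtinger f (p w) (q w) w"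
    and p: "has_wirtinger p r s z" and q: "has_wirtinger q s' t z"
  shows "laplacian f z = 2 * (s + s')"
proof -
  have "has_wirtinger (\<lambda>w. p w + q w) (r + s') (s + t) z"
    using has_wirtinger_add[OF p q] .
  then have 1: "has_wirtinger (\<lambda>w. frechet_derivative f (at w) 1) (r + s') (s + t) z"
    by (rule has_wirtinger_cong_open[OF _ U]) (simp add: frechet_derivative_wirtinger[OF f])
  have "has_wirtinger (\<lambda>w. \<i> * (p w - q w)) (0 * (p z - q z) + \<i> * (r - s')) (0 * (p z - q z) + \<i> * (s - t)) z"
    by (intro has_wirtinger_mult has_wirtinger_diff has_wirtinger_const p q)
  then have 2: "has_wirtinger (\<lambda>w. frechet_derivative f (at w) \<i>)
      (0 * (p z - q z) + \<i> * (r - s')) (0 * (p z - q z) + \<i> * (s - t)) z"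
    by (rule has_wirtinger_cong_open[OF _ U]) (simp add: frechet_derivative_wirtinger[OF f] algebra_simps)
  show ?thesis
    unfolding laplacian_def frechet_derivative_wirtinger[OF 1] frechet_derivative_wirtinger[OF 2]
    by (simp add: algebra_simps)
qed

lemma Ck_on_polynomial_function:
  fixes f :: "complex \<Rightarrow> complex"
  shows "polynomial_function f \<Longrightarrow> Ck_on k U f"
proof (induction k arbitrary: f)
  case 0
  then show ?case by (simp add: continuous_on_polymonial_function)
next
  case (Suc k)
  obtain p q where pq: "polynomial_function p" "polynomial_function q"
    and w: "\<And>z. has_wirtinger f (p z) (q z) z"
    using polynomial_function_wirtinger[OF Suc.prems] by metis
  have "Ck_on k U (\<lambda>z. p z * v + q z * cnj v)" for v
    by (intro Suc.IH polynomial_function_add polynomial_function_times pq polynomial_function_const)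
  then show ?case
    by (simp add: frechet_derivative_wirtinger[OF w] has_wirtinger_differentiable[OF w])
qed

lemma continuous_on_in_L2:
  assumes S: "open S" "bounded S" and f: "continuous_on S f" and M: "\<And>z. z \<in> S \<Longrightarrow> cmod (f z) \<le> M"
  shows "f \<in> L2 S"
proof -
  have "f \<in> borel_measurable (lebesgue_on S)"
    using S f by (intro continuous_imp_measurable_on_sets_lebesgue) auto
  moreover have "integrable lborel (\<lambda>z. if z \<in> S then (cmod (f z))\<^sup>2 else 0)"
    by (rule integrable_bounded_on_bounded_open[OF S, where B = "M\<^sup>2"])
      (use M in \<open>auto intro!: continuous_intros f power_mono\<close>)
  ultimately show ?thesis
    unfolding L2_def using S f by (simp add: integrable_lebesgue_on_open continuous_intros)
qed

text \<open>On a bounded set L^2 embeds in L^1, here through x \<le> 1 + x^2.\<close>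

lemma bergman_space_integrable:
  assumes S: "open S" "bounded S" and g: "g \<in> bergman_space S"
  shows "integrable lborel (\<lambda>z. if z \<in> S then cmod (g z) else 0)"
proof -
  have hol: "g holomorphic_on S" and L2: "integrable (lebesgue_on S) (\<lambda>z. (cmod (g z))\<^sup>2)"
    using g by (auto simp: bergman_space_def L2_def)
  have cg: "continuous_on S (\<lambda>z. cmod (g z))"
    using holomorphic_on_imp_continuous_on[OF hol] by (intro continuous_intros)
  have i2: "integrable lborel (\<lambda>z. if z \<in> S then (cmod (g z))\<^sup>2 else 0)"
    using L2 integrable_lebesgue_on_open[OF S(1), of "\<lambda>z. (cmod (g z))\<^sup>2"] cg
    by (simp add: continuous_intros)
  have i1: "integrable lborel (\<lambda>z. if z \<in> S then 1 else 0 :: real)"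
    by (rule integrable_bounded_on_bounded_open[OF S, where B = 1]) auto
  show ?thesis
  proof (rule Bochner_Integration.integrable_bound[OF Bochner_Integration.integrable_add[OF i1 i2]])
    have "x \<le> 1 + x\<^sup>2" for x :: real
      using zero_le_power2[of "x - 1"] by (simp add: power2_diff) (smt (verit) zero_le_power2)
    then show "AE z in lborel. norm (if z \<in> S then cmod (g z) else 0)
        \<le> norm ((if z \<in> S then 1 else 0) + (if z \<in> S then (cmod (g z))\<^sup>2 else 0))"
      by simp
    show "(\<lambda>z. if z \<in> S then cmod (g z) else 0) \<in> borel_measurable lborel"
      using borel_measurable_if_continuous_on[OF S(1) cg] by simp
  qed
qed

lemma bergman_projection_of_dirichlet_solution:
  assumes S: "open S" "bounded S"
    and q: "polynomial_function q" and Q: "polynomial_function Q"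
    and wQ: "\<And>z. has_wirtinger Q (q z) (q' z) z"
    and u: "is_dirichlet_solution S Q u" and P: "polynomial_function P"
    and uP: "\<And>z. z \<in> closure S \<Longrightarrow> u z = P z"
  obtains p where "polynomial_function p" "is_bergman_projection S q p"
proof -
  obtain p p2 r s t where pols: "polynomial_function p" "polynomial_function p2"
    "polynomial_function r" "polynomial_function s" "polynomial_function t"
    and wP: "\<And>z. has_wirtinger P (p z) (p2 z) z" and wp: "\<And>z. has_wirtinger p (r z) (s z) z"
    and wp2: "\<And>z. has_wirtinger p2 (s z) (t z) z"
    using polynomial_function_wirtinger2[OF P] by metis
  have cont: "continuous_on A f" if "polynomial_function f" for A and f :: "complex \<Rightarrow> complex"
    using that continuous_on_polymonial_function by blast
  have wu: "has_wirtinger u (p w) (p2 w) w" if "w \<in> S" for w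
    by (rule has_wirtinger_cong_open[OF wP S(1) that]) (use uP closure_subset in blast)
  \<comment> \<open>\<open>s\<close> is a quarter of the Laplacian and also the conjugate derivative
    of \<open>p\<close>, so its vanishing is the Cauchy-Riemann equation for
    \<open>p\<close>.\<close>
  have "s z = 0" if z: "z \<in> S" for z
  proof -
    have "laplacian u z = 0" using u z by (simp add: is_dirichlet_solution_def harmonic_on_def)
    with laplacian_wirtinger[OF S(1) z wu wp wp2] show ?thesis by simp
  qed
  then have "(p has_field_derivative r z) (at z)" if "z \<in> S" for z
    using has_wirtinger_imp_field_derivative wp[of z] that by metis
  then have hol: "p holomorphic_on S"
    using S(1) by (auto simp: holomorphic_on_open)
  have L2: "f \<in> L2 S" if f: "polynomial_function f" for f
  proof -
    obtain M where "\<And>z. z \<in> S \<Longrightarrow> cmod (f z) \<le> M"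
      using bounded_continuous_on_bounded[OF cont[OF f] S(2)] by blast
    then show ?thesis by (rule continuous_on_in_L2[OF S cont[OF f]])
  qed
  have "L2_inner S (\<lambda>z. q z - p z) g = 0" if g: "g \<in> bergman_space S" for g
  proof -
    have ghol: "g holomorphic_on S" using g by (simp add: bergman_space_def)
    have "L2_inner S (\<lambda>z. q z - p z) g = (LINT z|lborel. (if z \<in> S then (q z - p z) * cnj (g z) else 0))"
      unfolding L2_inner_def
      by (intro integral_lebesgue_on_open S continuous_intros cont q pols holomorphic_on_imp_continuous_on ghol)
    also have "\<dots> = 0"
    proof (rule integral_gradient_times_antiholomorphic[where \<phi> = "\<lambda>z. Q z - P z" and \<beta> = "\<lambda>z. q' z - p2 z"])
      show "Q z - P z = 0" if "z \<in> frontier S" for z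
        using u uP[of z] that by (auto simp: is_dirichlet_solution_def frontier_def)
    qed (use Q P wQ wP S ghol bergman_space_integrable[OF S g] in \<open>auto intro: has_wirtinger_diff\<close>)
    finally show ?thesis .
  qed
  then have "is_bergman_projection S q p"
    unfolding is_bergman_projection_def bergman_space_def using L2 q pols(1) hol
    by (simp add: bergman_space_def)
  then show thesis using that pols(1) by blast
qed

section \<open>Truncated Cauchy kernels\<close>

text \<open>1 / t, continued to the left of 1 by its tangent line at 1: this makes it C^1 and
  removes the pole.\<close>

definition kprofile :: "real \<Rightarrow> real" where
  "kprofile t = (if t \<le> 1 then 2 - t else 1 / t)"

lemma DERIV_kprofile: "(kprofile has_real_derivative - 1 / (max 1 t)\<^sup>2) (at t)"
proof (cases "t < 1")
  case True
  show ?thesis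
    by (rule has_field_derivative_transform_within_open[of "\<lambda>t. 2 - t" _ _ "{..<1}"])
      (use True in \<open>auto intro!: derivative_eq_intros simp: kprofile_def\<close>)
next
  case False
  show ?thesis
  \<comment> \<open>For t > 0 both branches are one formula, since (t - 1)^2 / t = t - 2 + 1 / t;
    this covers the joint at 1 as well.\<close>
  proof (rule has_field_derivative_transform_within_open[of "\<lambda>t. 2 - t + (max 0 (t - 1))\<^sup>2 / t" _ _ "{0<..}"])
    have "((\<lambda>t. (max 0 (t - 1))\<^sup>2) has_real_derivative 2 * max 0 (t - 1) * 1) (at t)"
      by (rule DERIV_chain2[OF DERIV_pos_part_sq]) (auto intro!: derivative_eq_intros)
    then have "((\<lambda>t. 2 - t + (max 0 (t - 1))\<^sup>2 / t) has_real_derivative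
        (0 - 1) + (2 * max 0 (t - 1) * 1 * t - (max 0 (t - 1))\<^sup>2 * 1) / (t * t)) (at t)"
      using False by (intro DERIV_add DERIV_diff DERIV_divide DERIV_const DERIV_ident) auto
    moreover have "(0 - 1) + (2 * max 0 (t - 1) * 1 * t - (max 0 (t - 1))\<^sup>2 * 1) / (t * t) = - 1 / (max 1 t)\<^sup>2"
      using False by (simp add: field_simps power2_eq_square)
    ultimately show "((\<lambda>t. 2 - t + (max 0 (t - 1))\<^sup>2 / t) has_real_derivative - 1 / (max 1 t)\<^sup>2) (at t)"
      by simp
    fix x :: real assume "x \<in> {0<..}"
    then show "2 - x + (max 0 (x - 1))\<^sup>2 / x = kprofile x"
      by (auto simp: kprofile_def max_def field_simps power2_eq_square)
  qed (use False in auto)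
qed

text \<open>A continuously differentiable truncation of the Cauchy kernel \<open>1 / z\<close> at scale \<open>e\<close>; its
  conjugate derivative is the bump \<open>cauchy_bump e\<close>, supported in the disc of radius \<open>e\<close>.\<close>

definition cauchy_kernel :: "real \<Rightarrow> complex \<Rightarrow> complex" where
  "cauchy_kernel e z = cnj z * of_real (kprofile ((cmod z)\<^sup>2 / e\<^sup>2) / e\<^sup>2)"

definition cauchy_bump :: "real \<Rightarrow> complex \<Rightarrow> real" where
  "cauchy_bump e z = 2 / e\<^sup>2 * max 0 (1 - (cmod z)\<^sup>2 / e\<^sup>2)"

text \<open>With k = \<open>kprofile\<close> and t = |z|^2 / e^2, the conjugate derivative is (t
  k(t))' / e^2: this is 2 (1 - t) / e^2 for t \<le> 1 and 0 beyond, where t k(t) = 1.\<close>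

lemma cauchy_kernel_wirtinger:
  assumes e: "e > 0"
  obtains a where "continuous_on UNIV a"
    "\<And>z. has_wirtinger (cauchy_kernel e) (a z) (of_real (cauchy_bump e z)) z"
proof -
  define D where "D x = - 1 / (max 1 (x / e\<^sup>2))\<^sup>2 / e\<^sup>2 / e\<^sup>2" for x
  have "((\<lambda>x. kprofile (x / e\<^sup>2) / e\<^sup>2) has_real_derivative D x) (at x)" for x
  proof -
    have "((\<lambda>x. kprofile (x / e\<^sup>2)) has_real_derivative - 1 / (max 1 (x / e\<^sup>2))\<^sup>2 * (1 / e\<^sup>2)) (at x)"
      by (rule DERIV_chain2[OF DERIV_kprofile DERIV_cdivide[OF DERIV_ident]])
    from DERIV_cdivide[OF this, of "e\<^sup>2"] show ?thesis by (simp add: D_def)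
  qed
  from has_wirtinger_norm_sq_compose[OF this]
  have w: "has_wirtinger (\<lambda>z. of_real (kprofile ((cmod z)\<^sup>2 / e\<^sup>2) / e\<^sup>2))
      (of_real (D ((cmod z)\<^sup>2)) * cnj z) (of_real (D ((cmod z)\<^sup>2)) * z) z" for z .
  have "has_wirtinger (\<lambda>z. z) 1 0 z" for z
    by (rule has_wirtinger_of_field_derivative) (rule DERIV_ident)
  from has_wirtinger_mult[OF has_wirtinger_cnj[OF this] w]
  have k: "has_wirtinger (cauchy_kernel e) (cnj z * (of_real (D ((cmod z)\<^sup>2)) * cnj z))
      (of_real (kprofile ((cmod z)\<^sup>2 / e\<^sup>2) / e\<^sup>2) + cnj z * (of_real (D ((cmod z)\<^sup>2)) * z)) z" for z
    unfolding cauchy_kernel_def[abs_def] by simp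
  have b: "of_real (kprofile ((cmod z)\<^sup>2 / e\<^sup>2) / e\<^sup>2) + cnj z * (of_real (D ((cmod z)\<^sup>2)) * z)
      = complex_of_real (cauchy_bump e z)" for z
  proof -
    define t where "t = (cmod z)\<^sup>2 / e\<^sup>2"
    have "cnj z * (of_real (D ((cmod z)\<^sup>2)) * z) = of_real ((cmod z)\<^sup>2 * D ((cmod z)\<^sup>2))"
      unfolding of_real_mult complex_norm_square by (simp only: mult_ac)
    also have "(cmod z)\<^sup>2 * D ((cmod z)\<^sup>2) = - t / (max 1 t)\<^sup>2 / e\<^sup>2"
      by (simp add: D_def t_def)
    finally have *: "cnj z * (of_real (D ((cmod z)\<^sup>2)) * z) = of_real (- t / (max 1 t)\<^sup>2 / e\<^sup>2)" .
    have "kprofile t - t / (max 1 t)\<^sup>2 = 2 * max 0 (1 - t)"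
      by (auto simp: kprofile_def max_def field_simps power2_eq_square)
    then have "kprofile t / e\<^sup>2 + - t / (max 1 t)\<^sup>2 / e\<^sup>2 = 2 / e\<^sup>2 * max 0 (1 - t)"
      using e by (simp add: field_simps)
    then show ?thesis
      unfolding * cauchy_bump_def t_def[symmetric] of_real_add[symmetric] by (simp only:)
  qed
  show thesis
  proof (rule that)
    have "max 1 x \<noteq> 0" for x :: real by (auto simp: max_def)
    then show "continuous_on UNIV (\<lambda>z. cnj z * (of_real (D ((cmod z)\<^sup>2)) * cnj z))"
      unfolding D_def using e by (intro continuous_intros) auto
  qed (use k b in simp)
qed

lemma cauchy_kernel_eq:
  assumes "e > 0" "e \<le> cmod z"
  shows "cauchy_kernel e z = 1 / z"
proof -
  have "kprofile ((cmod z)\<^sup>2 / e\<^sup>2) = e\<^sup>2 / (cmod z)\<^sup>2"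
  proof (cases "e = cmod z")
    case False
    then have "e\<^sup>2 < (cmod z)\<^sup>2" using assms by (intro power_strict_mono) auto
    then show ?thesis using assms by (simp add: kprofile_def field_simps)
  qed (use assms in \<open>simp add: kprofile_def\<close>)
  then have "cauchy_kernel e z = cnj z * of_real (1 / (cmod z)\<^sup>2)"
    using assms by (simp add: cauchy_kernel_def)
  also have "\<dots> = cnj z / (z * cnj z)"
    unfolding complex_norm_square[symmetric] by simp
  also have "\<dots> = 1 / z" using assms by (auto simp: field_simps)
  finally show ?thesis .
qed

lemma cmod_cauchy_kernel_le:
  assumes "e > 0"
  shows "cmod (cauchy_kernel e z) \<le> 2 / e"
proof (cases "e \<le> cmod z")
  case True
  then have "cmod (cauchy_kernel e z) = 1 / cmod z"
    using cauchy_kernel_eq[OF assms] by (simp add: norm_divide)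
  also have "\<dots> \<le> 2 / e" using True assms by (intro frac_le) auto
  finally show ?thesis .
next
  case False
  then have "(cmod z)\<^sup>2 \<le> e\<^sup>2" by (intro power_mono) auto
  then have t: "(cmod z)\<^sup>2 / e\<^sup>2 \<le> 1" "(cmod z)\<^sup>2 / e\<^sup>2 \<ge> 0" using assms by auto
  then have "\<bar>kprofile ((cmod z)\<^sup>2 / e\<^sup>2)\<bar> \<le> 2" by (simp add: kprofile_def)
  then have "\<bar>kprofile ((cmod z)\<^sup>2 / e\<^sup>2) / e\<^sup>2\<bar> \<le> 2 / e\<^sup>2"
    using divide_right_mono[of _ 2 "e\<^sup>2"] by simp
  then have "cmod z * \<bar>kprofile ((cmod z)\<^sup>2 / e\<^sup>2) / e\<^sup>2\<bar> \<le> e * (2 / e\<^sup>2)"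
    using False assms by (intro mult_mono) auto
  then show ?thesis using assms
    unfolding cauchy_kernel_def norm_mult norm_of_real complex_mod_cnj by (simp add: power2_eq_square)
qed

lemma cauchy_bump_nonneg: "cauchy_bump e z \<ge> 0"
  by (simp add: cauchy_bump_def)

lemma cauchy_bump_eq_0:
  assumes "e > 0" "e \<le> cmod z"
  shows "cauchy_bump e z = 0"
  using assms power_mono[of e "cmod z" 2] by (simp add: cauchy_bump_def field_simps)

lemma continuous_on_cauchy_bump: "e > 0 \<Longrightarrow> continuous_on A (cauchy_bump e)"
  unfolding cauchy_bump_def[abs_def] by (intro continuous_intros) auto

lemma continuous_on_cauchy_kernel: "e > 0 \<Longrightarrow> continuous_on A (cauchy_kernel e)"
  by (erule cauchy_kernel_wirtinger) (rule continuous_on_of_wirtinger)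

lemma integrable_cauchy_bump: "e > 0 \<Longrightarrow> integrable lborel (cauchy_bump e)"
  by (rule integrable_continuous_bounded_support[of _ e])
    (auto intro: continuous_on_cauchy_bump cauchy_bump_eq_0)

text \<open>Two truncated kernels agree outside the larger disc, so the conjugate derivative of
  their difference integrates to 0. The common value is pi; it appears later as a positive constant
  \<open>c\<close>.\<close>

lemma integral_cauchy_bump:
  assumes "e > 0" "d > 0"
  shows "(LINT z|lborel. cauchy_bump e z) = (LINT z|lborel. cauchy_bump d z)"
proof -
  obtain a where a: "continuous_on UNIV a" "\<And>z. has_wirtinger (cauchy_kernel e) (a z) (of_real (cauchy_bump e z)) z"
    using cauchy_kernel_wirtinger[OF assms(1)] by metis
  obtain b where b: "continuous_on UNIV b" "\<And>z. has_wirtinger (cauchy_kernel d) (b z) (of_real (cauchy_bump d z)) z"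
    using cauchy_kernel_wirtinger[OF assms(2)] by metis
  have "(LINT z|lborel. complex_of_real (cauchy_bump e z) - of_real (cauchy_bump d z)) = 0"
    by (rule integral_wirtinger_eq_0(2)[OF has_wirtinger_diff[OF a(2) b(2)], of "max e d"])
      (use assms in \<open>auto intro!: continuous_intros a b continuous_on_cauchy_bump simp: cauchy_kernel_eq\<close>)
  then have "(LINT z|lborel. complex_of_real (cauchy_bump e z - cauchy_bump d z)) = 0" by simp
  then show ?thesis
    unfolding integral_complex_of_real using integrable_cauchy_bump[OF assms(1)] integrable_cauchy_bump[OF assms(2)]
    by simp
qed

lemma integral_cauchy_bump_pos:
  assumes "e > 0"
  shows "(LINT z|lborel. cauchy_bump e z) > 0"
proof -
  have "(LINT z|lborel. cauchy_bump e z) \<ge> 0"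
    by (intro Bochner_Integration.integral_nonneg cauchy_bump_nonneg)
  moreover have "(LINT z|lborel. cauchy_bump e z) \<noteq> 0"
  proof
    assume "(LINT z|lborel. cauchy_bump e z) = 0"
    then have "AE z in lborel. cauchy_bump e z = 0"
      using integral_nonneg_eq_0_iff_AE[OF integrable_cauchy_bump[OF assms]] cauchy_bump_nonneg by simp
    then have "AE z in lborel. z \<notin> ball (0::complex) e"
    proof eventually_elim
      case (elim z)
      then show ?case
        using assms power_strict_mono[of "cmod z" e 2] by (auto simp: cauchy_bump_def field_simps)
    qed
    then have "emeasure lborel (ball (0::complex) e) = 0"
      by (subst (asm) AE_iff_measurable[of "ball 0 e"]) auto
    then have "measure lborel (ball (0::complex) e) = 0" by (simp add: measure_def)
    moreover have "measure lborel (ball (0::complex) e) > 0" using assms content_ball_pos by blast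
    ultimately show False by simp
  qed
  ultimately show ?thesis by simp
qed

section \<open>Holomorphic functions with prescribed boundary values\<close>

lemma uniform_limit_geometric:
  fixes f :: "nat \<Rightarrow> 'a \<Rightarrow> complex"
  assumes "\<And>n x. cmod (f (Suc n) x - f n x) \<le> C * (1/2) ^ n"
  obtains g where "uniform_limit UNIV f g sequentially"
proof -
  have "uniform_limit UNIV (\<lambda>n x. \<Sum>i<n. f (Suc i) x - f i x) (\<lambda>x. \<Sum>i. f (Suc i) x - f i x) sequentially"
    by (rule Weierstrass_m_test[where M = "\<lambda>n. C * (1/2) ^ n"])
      (use assms in \<open>auto intro!: summable_mult summable_geometric\<close>)
  then have "uniform_limit UNIV (\<lambda>n x. f 0 x + (\<Sum>i<n. f (Suc i) x - f i x))
      (\<lambda>x. f 0 x + (\<Sum>i. f (Suc i) x - f i x)) sequentially"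
    by (intro uniform_limit_intros)
  moreover have "f 0 x + (\<Sum>i<n. f (Suc i) x - f i x) = f n x" for n x
    using sum_lessThan_telescope[of "\<lambda>i. f i x" n] by simp
  ultimately have "uniform_limit UNIV (\<lambda>n x. f n x) (\<lambda>x. f 0 x + (\<Sum>i. f (Suc i) x - f i x)) sequentially"
    by (simp only:)
  then show thesis by (rule that)
qed

text \<open>An approximate identity argument; the bumps have mass \<open>c\<close> instead of 1,
  hence the factor in the limit.\<close>

lemma mollify_uniform_limit:
  fixes V :: "complex \<Rightarrow> complex"
  assumes V: "continuous_on UNIV V" and e: "\<And>n. e n > 0" "e \<longlonglongrightarrow> 0"
    and c: "\<And>n. (LINT z|lborel. cauchy_bump (e n) z) = c"
  shows "uniform_limit (cball a r) (\<lambda>n \<zeta>. LINT z|lborel. of_real (cauchy_bump (e n) z) * V (\<zeta> - z))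
    (\<lambda>\<zeta>. of_real c * V \<zeta>) sequentially"
proof (rule uniform_limitI)
  fix \<eta> :: real assume \<eta>: "\<eta> > 0"
  define b where "b n z = complex_of_real (cauchy_bump (e n) z)" for n z
  have ib: "integrable lborel (b n)" for n
    unfolding b_def using integrable_cauchy_bump[OF e(1)] by simp
  have b0: "b n z = 0" if "e n < cmod z" for n z
    using that e(1) by (simp add: b_def cauchy_bump_eq_0)
  have cpos: "c > 0" using integral_cauchy_bump_pos[OF e(1)[of 0]] c by simp
  have intb: "(LINT z|lborel. b n z) = of_real c" for n unfolding b_def by (simp add: c)
  define \<eta>' where "\<eta>' = \<eta> / (2 * c)"
  have \<eta>': "\<eta>' > 0" "\<eta>' * c < \<eta>" using \<eta> cpos by (auto simp: \<eta>'_def)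
  \<comment> \<open>Radius r + 1 leaves room for a shift by z with |z| \<le> e n < 1.\<close>
  have "uniformly_continuous_on (cball a (r + 1)) V"
    by (intro compact_uniformly_continuous continuous_on_subset[OF V]) auto
  then obtain \<delta> where \<delta>: "\<delta> > 0"
    and uc: "\<And>x y. x \<in> cball a (r + 1) \<Longrightarrow> y \<in> cball a (r + 1) \<Longrightarrow> dist y x < \<delta> \<Longrightarrow> dist (V y) (V x) < \<eta>'"
    unfolding uniformly_continuous_on_def using \<eta>' by metis
  have "eventually (\<lambda>n. e n < min \<delta> 1) sequentially"
    using order_tendstoD(2)[OF e(2), of "min \<delta> 1"] \<delta> by simp
  then show "\<forall>\<^sub>F n in sequentially. \<forall>\<zeta>\<in>cball a r.
      dist (LINT z|lborel. of_real (cauchy_bump (e n) z) * V (\<zeta> - z)) (of_real c * V \<zeta>) < \<eta>"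
  proof eventually_elim
    case (elim n)
    show ?case
    proof
      fix \<zeta> assume \<zeta>: "\<zeta> \<in> cball a r"
      have i: "integrable lborel (\<lambda>z. b n z * V (\<zeta> - z))"
        by (rule integrable_convolution[OF V ib b0])
      have "(LINT z|lborel. b n z * V (\<zeta> - z)) - of_real c * V \<zeta> =
          (LINT z|lborel. b n z * V (\<zeta> - z) - b n z * V \<zeta>)"
        using i ib by (simp add: intb)
      then have "cmod ((LINT z|lborel. b n z * V (\<zeta> - z)) - of_real c * V \<zeta>) \<le>
          (LINT z|lborel. cmod (b n z * V (\<zeta> - z) - b n z * V \<zeta>))"
        by (simp only: integral_norm_bound)
      also have "\<dots> \<le> (LINT z|lborel. \<eta>' * cauchy_bump (e n) z)"
      proof (rule integral_mono')
        show "integrable lborel (\<lambda>z. \<eta>' * cauchy_bump (e n) z)"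
          using integrable_cauchy_bump[OF e(1)] by simp
        fix z
        show "cmod (b n z * V (\<zeta> - z) - b n z * V \<zeta>) \<le> \<eta>' * cauchy_bump (e n) z"
        proof (cases "e n < cmod z")
          case False
          then have "dist (\<zeta> - z) \<zeta> < min \<delta> 1" using elim by (simp add: dist_norm)
          moreover from this have "\<zeta> - z \<in> cball a (r + 1)"
            using \<zeta> dist_triangle[of a "\<zeta> - z" \<zeta>] by (simp add: dist_commute)
          moreover have "\<zeta> \<in> cball a (r + 1)" using \<zeta> by simp
          ultimately have "cmod (V (\<zeta> - z) - V \<zeta>) \<le> \<eta>'"
            using uc[of \<zeta> "\<zeta> - z"] by (simp add: dist_norm)
          then have "cauchy_bump (e n) z * cmod (V (\<zeta> - z) - V \<zeta>) \<le> cauchy_bump (e n) z * \<eta>'"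
            by (intro mult_left_mono cauchy_bump_nonneg)
          moreover have "cmod (b n z * V (\<zeta> - z) - b n z * V \<zeta>) = cauchy_bump (e n) z * cmod (V (\<zeta> - z) - V \<zeta>)"
            unfolding right_diff_distrib[symmetric] norm_mult by (simp add: b_def cauchy_bump_nonneg)
          ultimately show ?thesis by (simp add: mult.commute)
        qed (use b0 \<eta>' cauchy_bump_nonneg in simp)
      qed (use \<eta>' cauchy_bump_nonneg in simp)
      also have "\<dots> = \<eta>' * c" by (simp add: c)
      also have "\<dots> < \<eta>" by (rule \<eta>')
      finally show "dist (LINT z|lborel. of_real (cauchy_bump (e n) z) * V (\<zeta> - z)) (of_real c * V \<zeta>) < \<eta>"
        by (simp add: dist_norm b_def)
    qed
  qed
qed

text \<open>The kernels at scales e and e / 2 differ only in the disc of radius e, by at most 4 / e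
  + 2 / e = 6 / e. The area of that disc, proportional to e^2, turns this into a bound linear in
  e.\<close>

lemma cauchy_transform_approx_diff:
  assumes w: "integrable lborel w" "\<And>z. R < cmod z \<Longrightarrow> w z = 0" "\<And>z. cmod (w z) \<le> M" and e: "e > 0"
  shows "cmod ((LINT z|lborel. w z * cauchy_kernel (e / 2) (\<zeta> - z)) - (LINT z|lborel. w z * cauchy_kernel e (\<zeta> - z)))
    \<le> M * (6 * unit_ball_vol 2) * e"
proof -
  have M: "M \<ge> 0" using w(3)[of 0] norm_ge_zero order_trans by blast
  have i: "integrable lborel (\<lambda>z. w z * cauchy_kernel d (\<zeta> - z))" if "d > 0" for d
    by (rule integrable_convolution[OF continuous_on_cauchy_kernel[OF that] w(1,2)])
  have "cmod ((LINT z|lborel. w z * cauchy_kernel (e / 2) (\<zeta> - z)) - (LINT z|lborel. w z * cauchy_kernel e (\<zeta> - z)))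
    = cmod (LINT z|lborel. w z * cauchy_kernel (e / 2) (\<zeta> - z) - w z * cauchy_kernel e (\<zeta> - z))"
    using i e by simp
  also have "\<dots> \<le> (LINT z|lborel. cmod (w z * cauchy_kernel (e / 2) (\<zeta> - z) - w z * cauchy_kernel e (\<zeta> - z)))"
    by (rule integral_norm_bound)
  also have "\<dots> \<le> (LINT z|lborel. M * (6 / e) * indicator (ball \<zeta> e) z)"
  proof (rule integral_mono')
    have "emeasure lborel (ball \<zeta> e) < \<infinity>" by (rule emeasure_bounded_finite) simp
    then show "integrable lborel (\<lambda>z. M * (6 / e) * indicator (ball \<zeta> e) z :: real)"
      by (intro integrable_mult_right integrable_real_indicator) auto
    fix z
    have eq: "cmod (w z * cauchy_kernel (e / 2) (\<zeta> - z) - w z * cauchy_kernel e (\<zeta> - z))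
        = cmod (w z) * cmod (cauchy_kernel (e / 2) (\<zeta> - z) - cauchy_kernel e (\<zeta> - z))"
      unfolding right_diff_distrib[symmetric] norm_mult ..
    show "cmod (w z * cauchy_kernel (e / 2) (\<zeta> - z) - w z * cauchy_kernel e (\<zeta> - z))
        \<le> M * (6 / e) * indicator (ball \<zeta> e) z"
    proof (cases "z \<in> ball \<zeta> e")
      case True
      have "cmod (cauchy_kernel (e / 2) (\<zeta> - z) - cauchy_kernel e (\<zeta> - z)) \<le> 2 / (e / 2) + 2 / e"
        using e by (intro order_trans[OF norm_triangle_ineq4] add_mono cmod_cauchy_kernel_le) auto
      also have "\<dots> = 6 / e" by simp
      finally have "cmod (w z) * cmod (cauchy_kernel (e / 2) (\<zeta> - z) - cauchy_kernel e (\<zeta> - z)) \<le> M * (6 / e)"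
        using w(3) M by (intro mult_mono) auto
      then show ?thesis unfolding eq using True by simp
    next
      case False
      then have "e \<le> cmod (\<zeta> - z)" by (simp add: dist_norm)
      then have "cauchy_kernel (e / 2) (\<zeta> - z) = cauchy_kernel e (\<zeta> - z)"
        using e by (simp add: cauchy_kernel_eq)
      then show ?thesis using False by simp
    qed
  qed (use e M in \<open>auto simp: indicator_def\<close>)
  also have "\<dots> = M * (6 / e) * measure lborel (ball \<zeta> e)" by simp
  also have "measure lborel (ball \<zeta> e) = unit_ball_vol 2 * e\<^sup>2"
    using e content_ball[of e \<zeta>] by simp
  also have "M * (6 / e) * (unit_ball_vol 2 * e\<^sup>2) = M * (6 * unit_ball_vol 2) * e"
    using e by (simp add: power2_eq_square)
  finally show ?thesis .
qed

text \<open>With \<open>w = W\<close> on \<open>S\<close> and \<open>0\<close> elsewhere, \<open>A = V - \<psi> / c\<close> where \<open>\<psi>\<close> is the Cauchy transform of \<open>w\<close>.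
  It is the limit of the convolutions of \<open>w\<close> with the truncated kernels, so that no singular integral
  is needed; inside \<open>S\<close> their conjugate derivatives cancel those of the mollifications of \<open>V\<close>.\<close>

lemma holomorphic_with_boundary_values:
  assumes S: "open S" "bounded S" and exterior: "frontier S \<subseteq> closure (- closure S)"
    and V: "\<And>z. has_wirtinger V (V1 z) (W z) z" and cont: "continuous_on UNIV V1" "continuous_on UNIV W"
    and orth: "\<And>\<zeta>. \<zeta> \<notin> closure S \<Longrightarrow> (LINT z|lborel. (if z \<in> S then W z * (1 / (\<zeta> - z)) else 0)) = 0"
  obtains A where "A holomorphic_on S" "continuous_on UNIV A" "\<And>z. z \<in> frontier S \<Longrightarrow> A z = V z"
proof -
  have cV: "continuous_on UNIV V" by (rule continuous_on_of_wirtinger[OF V])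
  obtain M where M: "\<And>z. z \<in> S \<Longrightarrow> cmod (W z) \<le> M" using bounded_continuous_on_bounded[OF cont(2) S(2)] by blast
  obtain R where R: "\<And>z. z \<in> S \<Longrightarrow> cmod z \<le> R" using S(2) bounded_iff by blast
  define w where "w z = (if z \<in> S then W z else 0)" for z
  have w_int: "integrable lborel w" unfolding w_def
    by (rule integrable_bounded_on_bounded_open[OF S continuous_on_subset[OF cont(2)] M]) auto
  have w_supp: "w z = 0" if "R < cmod z" for z using R[of z] that by (auto simp: w_def)
  have w_bd: "cmod (w z) \<le> max M 0" for z using M[of z] by (auto simp: w_def)
  \<comment> \<open>Halving matches \<open>cauchy_transform_approx_diff\<close>, so successive
    differences decay geometrically.\<close>
  define e where "e n = (1/2 :: real) ^ n" for n
  have e: "e n > 0" "e (Suc n) = e n / 2" for n by (auto simp: e_def)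
  have e0: "e \<longlonglongrightarrow> 0" unfolding e_def by (intro LIMSEQ_power_zero) simp
  define c where "c = (LINT z|lborel. cauchy_bump 1 z)"
  have c: "(LINT z|lborel. cauchy_bump (e n) z) = c" for n
    unfolding c_def by (rule integral_cauchy_bump) (use e in auto)
  have cpos: "c > 0" unfolding c_def by (rule integral_cauchy_bump_pos) simp
  define psi where "psi n \<zeta> = (LINT z|lborel. w z * cauchy_kernel (e n) (\<zeta> - z))" for n \<zeta>
  define mol where "mol n \<zeta> = (LINT z|lborel. of_real (cauchy_bump (e n) z) * V (\<zeta> - z))" for n \<zeta>
  have "cmod (psi (Suc n) \<zeta> - psi n \<zeta>) \<le> (max M 0 * (6 * unit_ball_vol 2)) * (1/2) ^ n" for n \<zeta>
    unfolding psi_def e(2) using cauchy_transform_approx_diff[OF w_int w_supp w_bd e(1)[of n]] by (simp add: e_def)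
  from uniform_limit_geometric[of psi, OF this] obtain \<Psi> where \<Psi>: "uniform_limit UNIV psi \<Psi> sequentially" .
  have psi_w: "\<exists>a. has_wirtinger (psi n) a (LINT z|lborel. w z * of_real (cauchy_bump (e n) (\<zeta> - z))) \<zeta>" for n \<zeta>
  proof -
    obtain a where a: "continuous_on UNIV a"
      "\<And>z. has_wirtinger (cauchy_kernel (e n)) (a z) (of_real (cauchy_bump (e n) z)) z"
      using cauchy_kernel_wirtinger[OF e(1)] by metis
    have b: "continuous_on UNIV (\<lambda>z. complex_of_real (cauchy_bump (e n) z))"
      by (intro continuous_intros continuous_on_cauchy_bump e)
    from has_wirtinger_convolution[OF a(2,1) b w_int w_supp] show ?thesis unfolding psi_def[abs_def] by blast
  qed
  have mol_w: "has_wirtinger (mol n) (LINT z|lborel. of_real (cauchy_bump (e n) z) * V1 (\<zeta> - z))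
      (LINT z|lborel. of_real (cauchy_bump (e n) z) * W (\<zeta> - z)) \<zeta>" for n \<zeta>
    unfolding mol_def[abs_def]
    by (rule has_wirtinger_convolution[OF V cont, where R = "e n"])
      (use integrable_cauchy_bump[OF e(1)] e(1) in \<open>auto simp: cauchy_bump_eq_0\<close>)
  \<comment> \<open>The support of the bump around \<zeta> lies in \<open>S\<close>, where w = W, so
    \<open>mol n\<close> and \<open>psi n\<close> have the same conjugate derivative at
    \<zeta>.\<close>
  have inner: "(\<lambda>\<zeta>. mol n \<zeta> - psi n \<zeta>) field_differentiable (at \<zeta>)" if \<zeta>: "ball \<zeta> (e n) \<subseteq> S" for n \<zeta>
  proof -
    obtain a where a: "has_wirtinger (psi n) a (LINT z|lborel. w z * of_real (cauchy_bump (e n) (\<zeta> - z))) \<zeta>"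
      using psi_w by blast
    have "(LINT z|lborel. w z * of_real (cauchy_bump (e n) (\<zeta> - z))) =
        (LINT z|lborel. w (\<zeta> - z) * of_real (cauchy_bump (e n) z))"
      using lborel_integral_reflect[of "\<lambda>z. w z * of_real (cauchy_bump (e n) (\<zeta> - z))" \<zeta>] by simp
    also have "\<dots> = (LINT z|lborel. of_real (cauchy_bump (e n) z) * W (\<zeta> - z))"
    proof (rule Bochner_Integration.integral_cong)
      fix z
      show "w (\<zeta> - z) * of_real (cauchy_bump (e n) z) = of_real (cauchy_bump (e n) z) * W (\<zeta> - z)"
      proof (cases "e n \<le> cmod z")
        case False
        then have "\<zeta> - z \<in> S" using \<zeta> by (auto simp: dist_norm)
        then show ?thesis by (simp add: w_def)
      qed (simp add: cauchy_bump_eq_0 e(1))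
    qed simp
    finally have "has_wirtinger (\<lambda>\<zeta>. mol n \<zeta> - psi n \<zeta>)
        ((LINT z|lborel. of_real (cauchy_bump (e n) z) * V1 (\<zeta> - z)) - a) 0 \<zeta>"
      using has_wirtinger_diff[OF mol_w[of n] a] by simp
    then show ?thesis
      unfolding field_differentiable_def using has_wirtinger_imp_field_derivative by blast
  qed
  have hol: "(\<lambda>\<zeta>. of_real c * V \<zeta> - \<Psi> \<zeta>) holomorphic_on S"
    unfolding holomorphic_on_def
  proof
    fix a assume "a \<in> S"
    then obtain r' where r': "r' > 0" "ball a r' \<subseteq> S" using S(1) openE by blast
    \<comment> \<open>Discs of radius e n < r about points of \<open>cball a r\<close> then stay
      inside \<open>ball a (2 * r)\<close>.\<close>
    define r where "r = r' / 2"
    have r: "r > 0" "ball a (2 * r) \<subseteq> S" using r' by (auto simp: r_def)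
    have lim: "uniform_limit (cball a r) (\<lambda>n \<zeta>. mol n \<zeta> - psi n \<zeta>) (\<lambda>\<zeta>. of_real c * V \<zeta> - \<Psi> \<zeta>) sequentially"
      unfolding mol_def
      by (intro uniform_limit_minus mollify_uniform_limit[OF cV e(1) e0 c] uniform_limit_on_subset[OF \<Psi>]) auto
    have "\<forall>\<^sub>F n in sequentially. e n < r" using order_tendstoD(2)[OF e0 r(1)] .
    then have "\<forall>\<^sub>F n in sequentially. continuous_on (cball a r) (\<lambda>\<zeta>. mol n \<zeta> - psi n \<zeta>) \<and>
        (\<lambda>\<zeta>. mol n \<zeta> - psi n \<zeta>) holomorphic_on ball a r"
    proof eventually_elim
      case (elim n)
      have "(\<lambda>\<zeta>. mol n \<zeta> - psi n \<zeta>) field_differentiable (at \<zeta>)" if "\<zeta> \<in> cball a r" for \<zeta>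
      proof (rule inner)
        have "y \<in> ball a (2 * r)" if "y \<in> ball \<zeta> (e n)" for y
          using \<open>\<zeta> \<in> cball a r\<close> that elim dist_triangle[of a y \<zeta>] by simp
        then show "ball \<zeta> (e n) \<subseteq> S" using r(2) by blast
      qed
      then have "(\<lambda>\<zeta>. mol n \<zeta> - psi n \<zeta>) holomorphic_on cball a r"
        unfolding holomorphic_on_def by (blast intro: field_differentiable_at_within)
      then show ?case
        using holomorphic_on_imp_continuous_on holomorphic_on_subset ball_subset_cball by blast
    qed
    then have "(\<lambda>\<zeta>. of_real c * V \<zeta> - \<Psi> \<zeta>) holomorphic_on ball a r"
      using holomorphic_uniform_limit[OF _ lim] by (metis (no_types, lifting) sequentially_bot)
    then have "(\<lambda>\<zeta>. of_real c * V \<zeta> - \<Psi> \<zeta>) field_differentiable (at a)"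
      using r(1) by (intro holomorphic_on_imp_differentiable_at[OF _ open_ball]) auto
    then show "(\<lambda>\<zeta>. of_real c * V \<zeta> - \<Psi> \<zeta>) field_differentiable (at a within S)"
      by (rule field_differentiable_at_within)
  qed
  have c\<Psi>: "continuous_on UNIV \<Psi>"
  proof (rule uniform_limit_theorem[OF _ \<Psi>])
    have "continuous_on UNIV (psi n)" for n
      using psi_w has_wirtinger_isCont by (meson continuous_at_imp_continuous_on)
    then show "\<forall>\<^sub>F n in sequentially. continuous_on UNIV (psi n)" by simp
  qed simp
  \<comment> \<open>Once \<open>e n\<close> is below the radius of a disc about \<zeta> in the
    exterior, the truncated kernel is the true Cauchy kernel on \<open>S\<close>, and
    \<open>orth\<close> applies.\<close>
  have "\<Psi> \<zeta> = 0" if \<zeta>: "\<zeta> \<in> - closure S" for \<zeta>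
  proof -
    obtain d where d: "d > 0" "ball \<zeta> d \<subseteq> - closure S" using openE[OF _ \<zeta>] by blast
    have "psi n \<zeta> = 0" if n: "e n < d" for n
    proof -
      have "w z * cauchy_kernel (e n) (\<zeta> - z) = (if z \<in> S then W z * (1 / (\<zeta> - z)) else 0)" for z
      proof (cases "z \<in> S")
        case True
        then have "z \<notin> ball \<zeta> d" using d closure_subset by blast
        then have "e n \<le> cmod (\<zeta> - z)" using n by (simp add: dist_norm)
        then show ?thesis using True by (simp add: w_def cauchy_kernel_eq e(1))
      qed (simp add: w_def)
      then show ?thesis unfolding psi_def using orth[of \<zeta>] \<zeta> by simp
    qed
    moreover have "\<forall>\<^sub>F n in sequentially. e n < d" using order_tendstoD(2)[OF e0 d(1)] .
    ultimately have "\<forall>\<^sub>F n in sequentially. psi n \<zeta> = 0" by (auto elim: eventually_mono)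
    then have "(\<lambda>n. psi n \<zeta>) \<longlonglongrightarrow> 0" by (rule tendsto_eventually)
    moreover have "(\<lambda>n. psi n \<zeta>) \<longlonglongrightarrow> \<Psi> \<zeta>" by (rule tendsto_uniform_limitI[OF \<Psi>]) simp
    ultimately show ?thesis using LIMSEQ_unique by blast
  qed
  \<comment> \<open>Frontier points are limits of exterior points, so continuity of \<Psi> carries
    the value 0 over.\<close>
  then have \<Psi>0: "\<Psi> z = 0" if "z \<in> frontier S" for z
    using continuous_constant_on_closure[of "- closure S" \<Psi> 0 z] continuous_on_subset[OF c\<Psi>] exterior that by blast
  show thesis
  proof (rule that)
    have "(\<lambda>z. (of_real c * V z - \<Psi> z) / of_real c) holomorphic_on S"
      using cpos by (intro holomorphic_on_divide[OF hol] holomorphic_intros) simp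
    then show "(\<lambda>z. V z - \<Psi> z / of_real c) holomorphic_on S"
      using cpos by (simp add: diff_divide_distrib)
    show "continuous_on UNIV (\<lambda>z. V z - \<Psi> z / of_real c)"
      using cpos by (intro continuous_intros cV c\<Psi>) auto
  qed (simp add: \<Psi>0)
qed

section \<open>From the Bergman projection to the Dirichlet problem\<close>

text \<open>At a boundary point \<open>r\<close> is nonnegative with nonzero gradient, so a short
  step in an ascending direction makes it positive. Within \<open>U\<close> the set where r > 0 is
  open and misses \<open>S\<close>, hence also its closure.\<close>

lemma smooth_boundary_frontier_subset:
  assumes "open S" "smooth_boundary S"
  shows "frontier S \<subseteq> closure (- closure S)"
proof
  fix p assume p: "p \<in> frontier S"
  obtain U and r :: "complex \<Rightarrow> real" and v where U: "open U" "p \<in> U" and sm: "smooth_on U r"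
    and v: "frechet_derivative r (at p) v \<noteq> 0" and SU: "S \<inter> U = {z\<in>U. r z < 0}"
    using assms(2) p unfolding smooth_boundary_def by blast
  have diff: "r differentiable (at z)" if "z \<in> U" for z
    using sm that unfolding smooth_on_def by (metis Ck_on.simps(2))
  then have cont: "continuous_on U r"
    by (meson continuous_at_imp_continuous_on differentiable_imp_continuous_within)
  have "p \<notin> S" using p assms(1) by (simp add: frontier_def interior_open)
  then have rp: "r p \<ge> 0" using SU U(2) by (metis (mono_tags, lifting) IntD1 mem_Collect_eq not_le)
  define D where "D = frechet_derivative r (at p)"
  have D: "(r has_derivative D) (at p)" unfolding D_def using diff[OF U(2)] frechet_derivative_works by blast
  have lin: "D (t *\<^sub>R x) = t * D x" for t x using linear_scale[OF has_derivative_linear[OF D]] by simp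
  \<comment> \<open>The sign turns \<open>v\<close> into a direction of increase.\<close>
  define u where "u = sgn (D v) *\<^sub>R v"
  have Du: "D u > 0" using v lin by (simp add: u_def D_def[symmetric] sgn_if)
  have der: "((\<lambda>t. r (p + t *\<^sub>R u)) has_real_derivative D u) (at 0)"
  proof -
    have "((\<lambda>t. p + t *\<^sub>R u) has_derivative (\<lambda>t. t *\<^sub>R u)) (at 0)"
      by (auto intro!: derivative_eq_intros)
    from has_derivative_compose[OF this, of r D] D have
      "((\<lambda>t. r (p + t *\<^sub>R u)) has_derivative (\<lambda>t. D (t *\<^sub>R u))) (at 0)" by simp
    moreover have "(\<lambda>t. D (t *\<^sub>R u)) = (*) (D u)" by (auto simp: lin)
    ultimately show ?thesis by (simp add: has_field_derivative_def)
  qed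
  show "p \<in> closure (- closure S)"
    unfolding closure_iff_nhds_not_empty
  proof (intro allI impI)
    fix T V assume "V \<subseteq> T" "open V" "p \<in> V"
    then obtain e where e: "e > 0" "ball p e \<subseteq> U \<inter> V" using U openE[of "U \<inter> V" p] by blast
    obtain d where d: "d > 0" "\<And>h. h > 0 \<Longrightarrow> h < d \<Longrightarrow> r (p + 0 *\<^sub>R u) < r (p + (0 + h) *\<^sub>R u)"
      using DERIV_pos_inc_right[OF der Du] by blast
    define m where "m = cmod u + 1"
    have m: "m > 0" "cmod u \<le> m" by (simp_all add: m_def add_nonneg_pos)
    define h where "h = min (d / 2) (e / (2 * m))"
    have h: "h > 0" "h < d" "h \<le> e / (2 * m)" using d(1) e(1) m(1) by (auto simp: h_def)
    have "h * cmod u \<le> e / (2 * m) * m"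
      by (intro mult_mono) (use h e m in auto)
    also have "\<dots> = e / 2" using m(1) by simp
    finally have "p + h *\<^sub>R u \<in> ball p e" using h e by (simp add: dist_norm)
    then have y: "p + h *\<^sub>R u \<in> U" "p + h *\<^sub>R u \<in> V" using e by auto
    have ry: "r (p + h *\<^sub>R u) > 0" using d(2)[OF h(1,2)] rp by simp
    have op: "open {z\<in>U. r z \<in> {0<..}}"
      using continuous_open_preimage[OF cont U(1), of "{0<..}"] by (simp add: vimage_def Int_def)
    have neg: "r z < 0" if "z \<in> S" "z \<in> U" for z using SU that by blast
    have "{z\<in>U. r z \<in> {0<..}} \<inter> S = {}" by (auto dest: neg)
    then have "{z\<in>U. r z \<in> {0<..}} \<inter> closure S = {}" using open_Int_closure_eq_empty[OF op] by blast
    then have "p + h *\<^sub>R u \<in> - closure S" using y ry by auto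
    then show "- closure S \<inter> T \<noteq> {}" using y \<open>V \<subseteq> T\<close> by blast
  qed
qed

text \<open>The maximum principle for F and -F gives Re F = 0 on \<open>S\<close>; a nonempty image
  inside the imaginary axis is not open, so the open mapping theorem leaves only constants.\<close>

lemma holomorphic_constant_if_Re_frontier_zero:
  assumes S: "open S" "connected S" "bounded S" and F: "F holomorphic_on S" "continuous_on (closure S) F"
    and Re0: "\<And>z. z \<in> frontier S \<Longrightarrow> Re (F z) = 0"
  shows "F constant_on S"
proof (rule ccontr)
  assume nc: "\<not> F constant_on S"
  have Re: "Re (F z) = 0" if "z \<in> S" for z
  proof -
    have "Re (F z) \<le> 0"
      by (rule maximum_real_frontier[of F S]) (use S F Re0 that in \<open>auto simp: interior_open\<close>)
    moreover have "Re (- F z) \<le> 0"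
      by (rule maximum_real_frontier[of "\<lambda>z. - F z" S])
        (use S F Re0 that in \<open>auto simp: interior_open intro!: holomorphic_intros continuous_intros\<close>)
    ultimately show ?thesis by simp
  qed
  have "open (F ` S)" using open_mapping_thm[OF F(1) S(1,2,1) order.refl nc] .
  moreover obtain z where z: "z \<in> S" using nc by (auto simp: constant_on_def)
  ultimately obtain e where e: "e > 0" "ball (F z) e \<subseteq> F ` S" using openE[of "F ` S" "F z"] by blast
  have "F z + of_real (e / 2) \<in> ball (F z) e" using e by (simp add: dist_norm)
  then obtain y where "y \<in> S" "F y = F z + of_real (e / 2)" using e by (metis imageE subsetD)
  then show False using Re[of y] Re[OF z] e by simp
qed

text \<open>On the frontier H + cnj K = 0 says that Re (H + K) and Im (H - K) vanish; hence H + K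
  and i (H - K) are both constant.\<close>

lemma holomorphic_constant_if_frontier_antiholomorphic:
  assumes S: "open S" "connected S" "bounded S"
    and H: "H holomorphic_on S" "continuous_on (closure S) H"
    and K: "K holomorphic_on S" "continuous_on (closure S) K"
    and fr: "\<And>z. z \<in> frontier S \<Longrightarrow> H z + cnj (K z) = 0"
  obtains c where "\<And>z. z \<in> closure S \<Longrightarrow> H z = c"
proof -
  have "(\<lambda>z. H z + K z) constant_on S"
  proof (rule holomorphic_constant_if_Re_frontier_zero[OF S])
    show "Re (H z + K z) = 0" if "z \<in> frontier S" for z using arg_cong[OF fr[OF that], of Re] by simp
  qed (intro holomorphic_intros continuous_intros H K)+
  moreover have "(\<lambda>z. \<i> * (H z - K z)) constant_on S"
  proof (rule holomorphic_constant_if_Re_frontier_zero[OF S])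
    show "Re (\<i> * (H z - K z)) = 0" if "z \<in> frontier S" for z using arg_cong[OF fr[OF that], of Im] by simp
  qed (intro holomorphic_intros continuous_intros H K)+
  ultimately obtain a b where ab: "\<And>z. z \<in> S \<Longrightarrow> H z + K z = a" "\<And>z. z \<in> S \<Longrightarrow> \<i> * (H z - K z) = b"
    unfolding constant_on_def by metis
  have "H z = (a - \<i> * b) / 2" if "z \<in> S" for z
    using ab[OF that] by (auto simp: complex_eq_iff)
  then have "H z = (a - \<i> * b) / 2" if "z \<in> closure S" for z
    using continuous_constant_on_closure[OF H(2) _ that] by blast
  then show thesis using that by blast
qed

section \<open>Boundary values from the projection; harmonic polynomials\<close>

lemma has_wirtinger_poly: "has_wirtinger (poly P) (poly (pderiv P) z) 0 z"
  by (rule has_wirtinger_of_field_derivative) (rule poly_DERIV)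

lemma inverse_diff_in_bergman_space:
  assumes S: "open S" "bounded S" and \<zeta>: "\<zeta> \<notin> closure S"
  shows "(\<lambda>z. 1 / (\<zeta> - z)) \<in> bergman_space S"
proof -
  have "\<zeta> \<noteq> z" if "z \<in> S" for z using \<zeta> that closure_subset by blast
  then have hol: "(\<lambda>z. 1 / (\<zeta> - z)) holomorphic_on S"
    by (intro holomorphic_intros) auto
  obtain d where d: "d > 0" "ball \<zeta> d \<subseteq> - closure S" using openE[of "- closure S" \<zeta>] \<zeta> by auto
  have "cmod (1 / (\<zeta> - z)) \<le> 1 / d" if "z \<in> S" for z
  proof -
    have "z \<notin> ball \<zeta> d" using d that closure_subset by blast
    then have "d \<le> cmod (\<zeta> - z)" by (simp add: dist_norm)
    then show ?thesis using d by (simp add: norm_divide frac_le)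
  qed
  then have "(\<lambda>z. 1 / (\<zeta> - z)) \<in> L2 S"
    by (rule continuous_on_in_L2[OF S holomorphic_on_imp_continuous_on[OF hol]])
  then show ?thesis using hol by (simp add: bergman_space_def)
qed

text \<open>Conjugation turns orthogonality of q - h to 1 / (\<zeta> - z) into vanishing of the
  Cauchy transform of W = cnj (q - P), the conjugate derivative of cnj (Q - R). In this form the
  corrected function is holomorphic instead of antiholomorphic.\<close>

lemma polynomial_projection_boundary_values:
  assumes S: "open S" "connected S" "bounded S" and exterior: "frontier S \<subseteq> closure (- closure S)"
    and Q: "polynomial_function Q" and wQ: "\<And>z. has_wirtinger Q (q z) (q' z) z"
    and q: "polynomial_function q" and q': "polynomial_function q'"
    and h: "is_bergman_projection S q h" and p: "polynomial_function p" and hp: "\<And>z. z \<in> S \<Longrightarrow> h z = p z"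
  obtains A and R :: "complex poly" where "A holomorphic_on S" "continuous_on UNIV A"
    "\<And>z. z \<in> frontier S \<Longrightarrow> A z = cnj (Q z - poly R z)"
proof -
  have hhol: "h holomorphic_on S" using h by (simp add: is_bergman_projection_def bergman_space_def)
  \<comment> \<open>Holomorphy reduces \<open>p\<close> to a polynomial in z alone, which has a
    polynomial antiderivative.\<close>
  then have "p holomorphic_on S" using hp holomorphic_transform by metis
  then obtain P :: "complex poly" where P: "\<And>z. z \<in> S \<Longrightarrow> p z = poly P z"
    using holomorphic_polynomial_function_eq_poly[OF p _ S(1,2)] by metis
  obtain R where R: "pderiv R = P" using poly_antiderivative by metis
  have cont: "continuous_on A f" if "polynomial_function f" for A and f :: "complex \<Rightarrow> complex"
    using that continuous_on_polymonial_function by blast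
  have cP: "continuous_on A (poly P)" for A by (rule cont[OF polynomial_function_poly])
  define W where "W z = cnj (q z - poly P z)" for z
  have wV: "has_wirtinger (\<lambda>z. cnj (Q z - poly R z)) (cnj (q' z)) (W z) z" for z
    using has_wirtinger_cnj[OF has_wirtinger_diff[OF wQ has_wirtinger_poly[of R]]] by (simp add: W_def R)
  have orth: "(LINT z|lborel. (if z \<in> S then W z * (1 / (\<zeta> - z)) else 0)) = 0" if \<zeta>: "\<zeta> \<notin> closure S" for \<zeta>
  proof -
    have g: "(\<lambda>z. 1 / (\<zeta> - z)) \<in> bergman_space S" by (rule inverse_diff_in_bergman_space[OF S(1,3) \<zeta>])
    have "continuous_on S (\<lambda>z. (q z - h z) * cnj (1 / (\<zeta> - z)))"
      by (intro continuous_on_mult continuous_on_diff continuous_on_cnj cont q holomorphic_on_imp_continuous_on hhol)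
        (use g in \<open>simp add: bergman_space_def\<close>)
    from integral_lebesgue_on_open[OF S(1) this]
    have "L2_inner S (\<lambda>z. q z - h z) (\<lambda>z. 1 / (\<zeta> - z)) =
        (LINT z|lborel. (if z \<in> S then (q z - h z) * cnj (1 / (\<zeta> - z)) else 0))"
      by (simp only: L2_inner_def)
    moreover have "L2_inner S (\<lambda>z. q z - h z) (\<lambda>z. 1 / (\<zeta> - z)) = 0"
      using h g by (simp add: is_bergman_projection_def)
    ultimately have "(LINT z|lborel. cnj (if z \<in> S then (q z - h z) * cnj (1 / (\<zeta> - z)) else 0)) = 0"
      unfolding integral_cnj by simp
    moreover have "cnj (if z \<in> S then (q z - h z) * cnj (1 / (\<zeta> - z)) else 0) =
        (if z \<in> S then W z * (1 / (\<zeta> - z)) else 0)" for z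
      using hp[of z] P[of z] by (simp add: W_def)
    ultimately show ?thesis by (simp only:)
  qed
  have "continuous_on UNIV W" unfolding W_def by (intro continuous_intros cont q cP)
  moreover have "continuous_on UNIV (\<lambda>z. cnj (q' z))" by (intro continuous_intros cont q')
  ultimately show thesis
    using holomorphic_with_boundary_values[OF S(1,3) exterior wV _ _ orth] that by blast
qed

lemma is_dirichlet_solution_poly:
  fixes R1 R2 :: "complex poly"
  assumes "\<And>z. z \<in> frontier S \<Longrightarrow> Q z = poly R1 z + cnj (poly R2 z) - c" and "open S"
  shows "is_dirichlet_solution S Q (\<lambda>z. poly R1 z + cnj (poly R2 z) - c)"
    and "polynomial_function (\<lambda>z. poly R1 z + cnj (poly R2 z) - c)"
proof -
  let ?u = "\<lambda>z. poly R1 z + cnj (poly R2 z) - c"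
  show pu: "polynomial_function ?u"
    by (intro polynomial_function_diff polynomial_function_add polynomial_function_poly
        polynomial_function_cnj polynomial_function_const)
  have 1: "has_wirtinger ?u (poly (pderiv R1) z) (cnj (poly (pderiv R2) z)) z" for z
    using has_wirtinger_diff[OF has_wirtinger_add[OF has_wirtinger_poly has_wirtinger_cnj[OF has_wirtinger_poly]]
        has_wirtinger_const] by simp
  have 2: "has_wirtinger (\<lambda>z. cnj (poly (pderiv R2) z)) 0 (cnj (poly (pderiv (pderiv R2)) z)) z" for z
    using has_wirtinger_cnj[OF has_wirtinger_poly] by simp
  have "laplacian ?u z = 0" if "z \<in> S" for z
    using laplacian_wirtinger[OF assms(2) that 1 has_wirtinger_poly 2] by simp
  then show "is_dirichlet_solution S Q ?u"
    unfolding is_dirichlet_solution_def harmonic_on_def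
    using assms(1) Ck_on_polynomial_function[OF pu] continuous_on_polymonial_function[OF pu] by auto
qed

theorem proposition2p1:
  fixes \<Omega> :: "complex set"
  assumes "open \<Omega>" and "connected \<Omega>" and "bounded \<Omega>" and "smooth_boundary \<Omega>"
  shows "(\<forall>q::complex \<Rightarrow> complex. polynomial_function q \<longrightarrow>
            (\<exists>h. is_bergman_projection \<Omega> q h \<and>
                 (\<exists>p. polynomial_function p \<and> (\<forall>z\<in>\<Omega>. h z = p z))))
     \<longleftrightarrow>
         (\<forall>Q::complex \<Rightarrow> complex. polynomial_function Q \<longrightarrow>
            (\<exists>u. is_dirichlet_solution \<Omega> Q u \<and>
                 (\<exists>P. polynomial_function P \<and> (\<forall>z\<in>closure \<Omega>. u z = P z))))"
    (is "?bergman \<longleftrightarrow> ?dirichlet")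
proof
  assume ?dirichlet
  show ?bergman
  proof (intro allI impI)
    fix q :: "complex \<Rightarrow> complex" assume q: "polynomial_function q"
    obtain Q q' where Q: "polynomial_function Q" "\<And>z. has_wirtinger Q (q z) (q' z) z"
      using polynomial_function_antiderivative[OF q] by metis
    obtain u P where "is_dirichlet_solution \<Omega> Q u" "polynomial_function P" "\<And>z. z \<in> closure \<Omega> \<Longrightarrow> u z = P z"
      using \<open>?dirichlet\<close> Q(1) by metis
    from bergman_projection_of_dirichlet_solution[OF assms(1,3) q Q this]
    show "\<exists>h. is_bergman_projection \<Omega> q h \<and> (\<exists>p. polynomial_function p \<and> (\<forall>z\<in>\<Omega>. h z = p z))"
      by metis
  qed
next
  assume ?bergman
  note exterior = smooth_boundary_frontier_subset[OF assms(1,4)]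
  have *: "\<exists>A (R :: complex poly). A holomorphic_on \<Omega> \<and> continuous_on UNIV A \<and>
      (\<forall>z\<in>frontier \<Omega>. A z = cnj (Q z - poly R z))" if Q: "polynomial_function Q" for Q
  proof -
    obtain q q' where q: "polynomial_function q" "polynomial_function q'" "\<And>z. has_wirtinger Q (q z) (q' z) z"
      using polynomial_function_wirtinger[OF Q] by metis
    obtain h p where "is_bergman_projection \<Omega> q h" "polynomial_function p" "\<And>z. z \<in> \<Omega> \<Longrightarrow> h z = p z"
      using \<open>?bergman\<close> q(1) by metis
    from polynomial_projection_boundary_values[OF assms(1-3) exterior Q q(3,1,2) this]
    show ?thesis by metis
  qed
  show ?dirichlet
  proof (intro allI impI)
    fix Q :: "complex \<Rightarrow> complex" assume Q: "polynomial_function Q"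
    obtain A1 and R1 :: "complex poly" where 1: "A1 holomorphic_on \<Omega>" "continuous_on UNIV A1"
      "\<And>z. z \<in> frontier \<Omega> \<Longrightarrow> A1 z = cnj (Q z - poly R1 z)"
      using *[OF Q] by metis
    obtain A2 and R2 :: "complex poly" where 2: "A2 holomorphic_on \<Omega>" "continuous_on UNIV A2"
      "\<And>z. z \<in> frontier \<Omega> \<Longrightarrow> A2 z = cnj (cnj (Q z) - poly R2 z)"
      using *[OF polynomial_function_cnj[OF Q]] by metis
    \<comment> \<open>On the frontier Q = R1 + cnj A1 and Q = cnj R2 + A2; subtracting gives H + cnj
      K = 0 with H = R1 - A2 and K = A1 - R2.\<close>
    obtain c where c: "\<And>z. z \<in> closure \<Omega> \<Longrightarrow> poly R1 z - A2 z = c"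
    proof (rule holomorphic_constant_if_frontier_antiholomorphic[OF assms(1-3),
          of "\<lambda>z. poly R1 z - A2 z" "\<lambda>z. A1 z - poly R2 z"])
      show "(\<lambda>z. poly R1 z - A2 z) holomorphic_on \<Omega>" "(\<lambda>z. A1 z - poly R2 z) holomorphic_on \<Omega>"
        by (intro holomorphic_intros 1 2)+
      show "continuous_on (closure \<Omega>) (\<lambda>z. poly R1 z - A2 z)" "continuous_on (closure \<Omega>) (\<lambda>z. A1 z - poly R2 z)"
        by (intro continuous_intros continuous_on_subset[OF 1(2)] continuous_on_subset[OF 2(2)] subset_UNIV)+
      show "poly R1 z - A2 z + cnj (A1 z - poly R2 z) = 0" if "z \<in> frontier \<Omega>" for z
        using 1(3)[OF that] 2(3)[OF that] by simp
    qed (rule that)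
    \<comment> \<open>Insert A2 = R1 - c into Q = A2 + cnj R2.\<close>
    have fr: "Q z = poly R1 z + cnj (poly R2 z) - c" if "z \<in> frontier \<Omega>" for z
      using c[of z] 2(3)[OF that] that by (auto simp: frontier_def algebra_simps)
    show "\<exists>u. is_dirichlet_solution \<Omega> Q u \<and> (\<exists>P. polynomial_function P \<and> (\<forall>z\<in>closure \<Omega>. u z = P z))"
      using is_dirichlet_solution_poly[OF fr assms(1)] by blast
  qed
qed

end
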